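(* Let $G$ be a finite group and let $n\geq 1$, $d\geq 2$ be integers. The poset $Q_n^{0\,\mathrm{mod}\,d}(G)$ is a pure join semilattice and has a recursive atom ordering. Its rank function is \[ \mathrm{rk}(J,\pi)=\begin{cases}0, & \text{if } (J,\pi)=\hat0,\\[2pt] \lfloor\frac{n}{d}\rfloor+1-\frac{|\pi|}{|G|}, & \text{otherwise.}\end{cases} \] Its length is $\lfloor\frac{n}{d}\rfloor+1$.
   Context: Write $[n]=\{1,\dots,n\}$. A partition of a finite set $I$ is a set of nonempty disjoint subsets of $I$ (its parts) whose union is $I$; the empty set has exactly one partition, the empty one. The finite group $G$ acts on $G\times[n]$ by left multiplication on the first factor. The Dowling lattice $Q_n(G)$ ($n\ge1$) is the poset of pairs $(J,\pi)$ where $J$ is a $G$-stable subset of $G\times[n]$ and $\pi$ is a partition of $(G\times[n])\setminus J$ whose parts are permuted freely by $G$ (i.e. for all $1\neq g\in G$ and $K\in\pi$, $K\neq g.K\in\pi$). The order is: $(J,\pi)\le(J',\pi')$ iff $J\subseteq J'$ and for every part $K\in\pi$, either $K\subseteq J'$ or $K$ is contained in a single part of $\pi'$. Its minimum $\hat 0$ is $(\emptyset,\{\{(g,m)\}: g\in G, m\in[n]\})$ and its maximum $\hat1$ is $(G\times[n],\emptyset)$. For $n\ge1$, $d\ge2$, $Q_n^{0\,\mathrm{mod}\,d}(G)$ is the sub-poset (with induced order) of $Q_n(G)$ consisting of pairs $(J,\pi)$ such that either (1) $(J,\pi)=\hat0$, i.e. $J=\emptyset$ and $|K|=1$ for all $K\in\pi$;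 or (2) $|K|\equiv0$ mod $d$ for all $K\in\pi$. A finite bounded poset is pure if all its maximal chains have the same length (number of elements minus one), called its length; the rank of $x$ is the length of $[\hat0,x]$. A join semilattice is a poset in which any two elements have a least upper bound. A finite pure bounded poset $P$ has (admits) a recursive atom ordering if its length is at most $1$, or its length is greater than $1$ and its atoms can be ordered $a_1,\dots,a_t$ such that: (i) for every $j$, the interval $[a_j,\hat1]$ admits a recursive atom ordering in which those atoms of $[a_j,\hat1]$ that lie in $[a_i,\hat1]$ for some $i<j$ come first; and (ii) for all $i<j$ and all $y$ with $a_i,a_j<y$, there are $k<j$ and $z\le y$ such that $z$ covers $a_j$ and $z>a_k$. *)

theory Defs
  imports Complex_Main "HOL-Algebra.Lattice" "HOL-Algebra.Coset" "HOL-Library.Disjoint_Sets"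
begin

section \<open>Finite bounded posets\<close>

text \<open>
  Posets are the records \<^typ>\<open>'a gorder\<close> of HOL-Algebra whose equivalence is equality
  (locale \<^locale>\<open>partial_order\<close>).  Sub-posets and intervals arise by restricting the carrier.
\<close>

definition maximal_chain :: "'a gorder \<Rightarrow> 'a set \<Rightarrow> bool" where
  "maximal_chain L C \<longleftrightarrow> pred_on.maxchain (carrier L) (le L) C"

definition finite_bounded_poset :: "'a gorder \<Rightarrow> bool" where
  "finite_bounded_poset L \<longleftrightarrow>
     partial_order L \<and> finite (carrier L) \<and>
     (\<exists>x. least L x (carrier L)) \<and> (\<exists>x. greatest L x (carrier L))"

definition pure_poset :: "'a gorder \<Rightarrow> bool" where
  "pure_poset L \<longleftrightarrow>
     finite_bounded_poset L \<and>
     (\<forall>C D. maximal_chain L C \<longrightarrow> maximal_chain L D \<longrightarrow> card C = card D)"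

text \<open>The length is meaningful only for pure posets; otherwise the description is unspecified.\<close>

definition poset_length :: "'a gorder \<Rightarrow> nat" where
  "poset_length L = (THE l. \<forall>C. maximal_chain L C \<longrightarrow> l = card C - 1)"

definition interval_poset :: "'a gorder \<Rightarrow> 'a \<Rightarrow> 'a \<Rightarrow> 'a gorder" where
  "interval_poset L x y = L\<lparr>carrier := \<lbrace>x..y\<rbrace>\<^bsub>L\<^esub>\<rparr>"

definition poset_rank :: "'a gorder \<Rightarrow> 'a \<Rightarrow> nat" where
  "poset_rank L x = poset_length (interval_poset L \<bottom>\<^bsub>L\<^esub> x)"

definition covers :: "'a gorder \<Rightarrow> 'a \<Rightarrow> 'a \<Rightarrow> bool" where
  "covers L y x \<longleftrightarrow>
     x \<in> carrier L \<and> y \<in> carrier L \<and> x \<sqsubset>\<^bsub>L\<^esub> y \<and>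
     \<not> (\<exists>z\<in>carrier L. x \<sqsubset>\<^bsub>L\<^esub> z \<and> z \<sqsubset>\<^bsub>L\<^esub> y)"

definition atoms :: "'a gorder \<Rightarrow> 'a set" where
  "atoms L = {a. covers L a \<bottom>\<^bsub>L\<^esub>}"


section \<open>Recursive atom orderings\<close>

text \<open>
  An ordering of the atoms is a duplicate-free list.  In length at most 1 every ordering
  (of the at most one atom) counts as recursive, so that the recursive condition (i) also makes
  sense for intervals of length at most 1.
\<close>

inductive recursive_atom_ordering :: "'a gorder \<Rightarrow> 'a list \<Rightarrow> bool" where
  short:
  "recursive_atom_ordering L as"
    if "pure_poset L" and "poset_length L \<le> 1"
      and "distinct as" and "set as = atoms L"
| long:
  "recursive_atom_ordering L as"
    if "pure_poset L" and "poset_length L > 1"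
      and "distinct as" and "set as = atoms L"
      and "\<forall>j<length as. \<exists>bs.
             recursive_atom_ordering (interval_poset L (as ! j) \<top>\<^bsub>L\<^esub>) bs \<and>
             (\<forall>p q. p < q \<longrightarrow> q < length bs \<longrightarrow>
                (\<exists>i<j. bs ! q \<in> \<lbrace>as ! i..\<top>\<^bsub>L\<^esub>\<rbrace>\<^bsub>L\<^esub>) \<longrightarrow>
                (\<exists>i<j. bs ! p \<in> \<lbrace>as ! i..\<top>\<^bsub>L\<^esub>\<rbrace>\<^bsub>L\<^esub>))"
      and "\<forall>j<length as. \<forall>i<j. \<forall>y\<in>carrier L.
             as ! i \<sqsubset>\<^bsub>L\<^esub> y \<longrightarrow> as ! j \<sqsubset>\<^bsub>L\<^esub> y \<longrightarrow>
             (\<exists>k<j. \<exists>z\<in>carrier L.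
                z \<sqsubseteq>\<^bsub>L\<^esub> y \<and> covers L z (as ! j) \<and> as ! k \<sqsubset>\<^bsub>L\<^esub> z)"

definition has_recursive_atom_ordering :: "'a gorder \<Rightarrow> bool" where
  "has_recursive_atom_ordering L \<longleftrightarrow> (\<exists>as. recursive_atom_ordering L as)"


section \<open>Dowling lattices\<close>

definition dowling_ground :: "('g, 'b) monoid_scheme \<Rightarrow> nat \<Rightarrow> ('g \<times> nat) set" where
  "dowling_ground G n = carrier G \<times> {1..n}"

definition dowling_act :: "('g, 'b) monoid_scheme \<Rightarrow> 'g \<Rightarrow> 'g \<times> nat \<Rightarrow> 'g \<times> nat" where
  "dowling_act G g = (\<lambda>(h, m). (g \<otimes>\<^bsub>G\<^esub> h, m))"

type_synonym 'g dowling = "('g \<times> nat) set \<times> ('g \<times> nat) set set"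

definition dowling_carrier :: "('g, 'b) monoid_scheme \<Rightarrow> nat \<Rightarrow> 'g dowling set" where
  "dowling_carrier G n = {(J, \<pi>).
     J \<subseteq> dowling_ground G n \<and>
     (\<forall>g\<in>carrier G. dowling_act G g ` J \<subseteq> J) \<and>
     partition_on (dowling_ground G n - J) \<pi> \<and>
     (\<forall>g\<in>carrier G - {\<one>\<^bsub>G\<^esub>}. \<forall>K\<in>\<pi>.
        dowling_act G g ` K \<noteq> K \<and> dowling_act G g ` K \<in> \<pi>)}"

definition dowling_le :: "'g dowling \<Rightarrow> 'g dowling \<Rightarrow> bool" where
  "dowling_le = (\<lambda>(J, \<pi>) (J', \<pi>').
     J \<subseteq> J' \<and> (\<forall>K\<in>\<pi>. K \<subseteq> J' \<or> (\<exists>K'\<in>\<pi>'. K \<subseteq> K')))"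

definition dowling_lattice :: "('g, 'b) monoid_scheme \<Rightarrow> nat \<Rightarrow> 'g dowling gorder" where
  "dowling_lattice G n = \<lparr>carrier = dowling_carrier G n, eq = (=), le = dowling_le\<rparr>"

definition dowling_zero :: "('g, 'b) monoid_scheme \<Rightarrow> nat \<Rightarrow> 'g dowling" where
  "dowling_zero G n = ({}, {{(g, m)} | g m. g \<in> carrier G \<and> m \<in> {1..n}})"

definition dowling_mod :: "('g, 'b) monoid_scheme \<Rightarrow> nat \<Rightarrow> nat \<Rightarrow> 'g dowling gorder" where
  "dowling_mod G n d = (dowling_lattice G n)
     \<lparr>carrier := {(J, \<pi>) \<in> carrier (dowling_lattice G n).
        (J, \<pi>) = dowling_zero G n \<or> (\<forall>K\<in>\<pi>. d dvd card K)}\<rparr>"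

end

theory Submission
  imports Defs
begin

text \<open>
  Choosing one block from each \<open>G\<close>-orbit of parts turns an element of the Dowling lattice into a family
  of disjoint partial transversals of the columns, and merging, splitting or exchanging blocks becomes an
  elementary operation on such families. Any single relation (``\<open>x\<close> lies in \<open>J\<close>'' or ``\<open>x\<close> and
  \<open>y\<close> lie together'') can be imposed on an element in a least way, and doing so removes exactly one orbit
  of parts. This gives joins, the rank function and semimodularity above every nonzero element, so that in
  the intervals above atoms every ordering of the atoms is recursive.

  The atoms themselves are ordered by a numerical weight. Given an atom \<open>a\<close> below \<open>y\<close>, one merges a
  block into \<open>J\<close>, or two blocks with each other, staying below \<open>y\<close>, and re-splits the result more
  economically into an atom of smaller weight. An atom for which no such improvement exists has constant
  labels on the blocks inside the \<open>J\<close>-part of \<open>y\<close>, and its blocks inside each component of \<open>y\<close> occupy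
  consecutive runs of \<open>d\<close> columns. Hence it is unique, and it is the first atom below \<open>y\<close>.
\<close>

section \<open>Graded and semimodular posets\<close>

text \<open>The obstacle is the bottom. Above a nonzero element the poset agrees with the Dowling
  lattice, because divisibility of part sizes passes to larger elements; semimodularity then gives
  the exchange condition with \<open>k = i\<close>. The step from \<open>dowling_zero\<close> to an
  atom, however, can skip many elements of the lattice: two atoms may have a join of rank far above
  2, so \<open>k\<close> must in general belong to a third atom and the order of the atoms matters.
  It is enough that every atom below \<open>y\<close>, except the first, has a cover
  \<open>t\<close> below \<open>y\<close> lying also above an atom of strictly smaller weight. One
  weight must serve all \<open>y\<close>, although the best atom depends on \<open>y\<close>. Inside
  the \<open>J\<close>-part of \<open>y\<close> labels are free and columns can be traded with the
  atom's own \<open>J\<close>-part; inside a part of \<open>y\<close> labels are forced and columns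
  can only be redistributed. Hence three terms: a linear one for the columns used, a concave one
  that rewards uneven column sums, a small one for labels. The first atom below \<open>y\<close> is
  never constructed: existence of an atom of least weight and uniqueness of the non-improvable one
  suffice.\<close>

locale graded_poset = partial_order L for L :: "'a gorder" (structure) +
  fixes \<rho> :: "'a \<Rightarrow> nat" and b t :: 'a
  assumes finite_carrier: "finite (carrier L)"
    and b_least: "least L b (carrier L)"
    and t_greatest: "greatest L t (carrier L)"
    and rank_covers: "covers L y x \<Longrightarrow> \<rho> y = Suc (\<rho> x)"
begin

lemma b_closed: "b \<in> carrier L" and b_le: "x \<in> carrier L \<Longrightarrow> b \<sqsubseteq> x"
  using b_least by (auto simp: least_def)

lemma t_closed: "t \<in> carrier L" and le_t: "x \<in> carrier L \<Longrightarrow> x \<sqsubseteq> t"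
  using t_greatest by (auto simp: greatest_def)

lemma bottom_eq_b: "\<bottom> = b"
  unfolding bottom_def using b_least least_unique by blast

lemma top_eq_t: "\<top> = t"
  unfolding top_def using t_greatest greatest_unique by blast

lemma finite_bounded: "finite_bounded_poset L"
  unfolding finite_bounded_poset_def
  using partial_order_axioms finite_carrier b_least t_greatest by blast

text \<open>Finiteness alone gives the cover, by minimising the number of elements below; that
  \<open>\<rho>\<close> increases along the order is only deduced from this afterwards.\<close>

lemma ex_cover_le:
  assumes "x \<in> carrier L" "y \<in> carrier L" "x \<sqsubset> y"
  obtains z where "covers L z x" "z \<sqsubseteq> y"
proof -
  define A where "A = {z \<in> carrier L. x \<sqsubset> z \<and> z \<sqsubseteq> y}"
  define m where "m z = card {w \<in> carrier L. w \<sqsubseteq> z}" for z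
  have "y \<in> A"
    using assms by (auto simp: A_def)
  then obtain z where z: "z \<in> A" "\<And>w. w \<in> A \<Longrightarrow> m z \<le> m w"
    using ex_has_least_nat[of "\<lambda>z. z \<in> A" y m] by blast
  have "\<not> (x \<sqsubset> w \<and> w \<sqsubset> z)" if w: "w \<in> carrier L" for w
  proof
    assume xw: "x \<sqsubset> w \<and> w \<sqsubset> z"
    then have "w \<sqsubseteq> z" "w \<noteq> z"
      by (auto simp: lless_eq)
    have "{v \<in> carrier L. v \<sqsubseteq> w} \<subset> {v \<in> carrier L. v \<sqsubseteq> z}"
    proof
      show "{v \<in> carrier L. v \<sqsubseteq> w} \<subseteq> {v \<in> carrier L. v \<sqsubseteq> z}"
        using \<open>w \<sqsubseteq> z\<close> w z(1) le_trans by (auto simp: A_def)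
      have "\<not> z \<sqsubseteq> w"
        using \<open>w \<sqsubseteq> z\<close> \<open>w \<noteq> z\<close> w z(1) le_antisym by (auto simp: A_def)
      then show "{v \<in> carrier L. v \<sqsubseteq> w} \<noteq> {v \<in> carrier L. v \<sqsubseteq> z}"
        using z(1) by (auto simp: A_def)
    qed
    then have "m w < m z"
      unfolding m_def using finite_carrier by (intro psubset_card_mono) auto
    moreover have "w \<in> A"
      using xw w z(1) assms(2) \<open>w \<sqsubseteq> z\<close> le_trans by (auto simp: A_def)
    ultimately show False
      using z(2) by fastforce
  qed
  then show thesis
    using that[of z] z(1) assms(1) by (auto simp: A_def covers_def)
qed

lemma rank_less:
  assumes "x \<in> carrier L" "y \<in> carrier L" "x \<sqsubset> y"
  shows "\<rho> x < \<rho> y"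
  using assms
proof (induction "card {w \<in> carrier L. x \<sqsubset> w}" arbitrary: x rule: less_induct)
  case less
  obtain z where z: "covers L z x" "z \<sqsubseteq> y"
    using ex_cover_le less.prems by blast
  then have zc: "z \<in> carrier L" "x \<sqsubset> z"
    by (auto simp: covers_def)
  show ?case
  proof (cases "z = y")
    case True
    then show ?thesis
      using rank_covers z by fastforce
  next
    case False
    then have "z \<sqsubset> y"
      using z by (auto simp: lless_eq)
    have "{w \<in> carrier L. z \<sqsubset> w} \<subset> {w \<in> carrier L. x \<sqsubset> w}"
    proof
      show "{w \<in> carrier L. z \<sqsubset> w} \<subseteq> {w \<in> carrier L. x \<sqsubset> w}"
        using zc less.prems(1) lless_trans by blast
      have "\<not> z \<sqsubset> z"
        by (auto simp: lless_eq)
      then show "{w \<in> carrier L. z \<sqsubset> w} \<noteq> {w \<in> carrier L. x \<sqsubset> w}"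
        using zc by auto
    qed
    then have "card {w \<in> carrier L. z \<sqsubset> w} < card {w \<in> carrier L. x \<sqsubset> w}"
      using finite_carrier by (intro psubset_card_mono) auto
    then have "\<rho> z < \<rho> y"
      using less.hyps zc(1) less.prems(2) \<open>z \<sqsubset> y\<close> by blast
    then show ?thesis
      using rank_covers z(1) by fastforce
  qed
qed

lemma rank_le: "x \<in> carrier L \<Longrightarrow> y \<in> carrier L \<Longrightarrow> x \<sqsubseteq> y \<Longrightarrow> \<rho> x \<le> \<rho> y"
  using rank_less lless_eq by (cases "x = y") (simp_all add: less_imp_le)

lemma covers_iff_rank:
  assumes "x \<in> carrier L" "y \<in> carrier L" "x \<sqsubset> y"
  shows "covers L y x \<longleftrightarrow> \<rho> y = Suc (\<rho> x)"
proof
  assume *: "\<rho> y = Suc (\<rho> x)"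
  show "covers L y x"
    unfolding covers_def using assms rank_less * by (metis less_Suc_eq not_less_iff_gr_or_eq)
qed (rule rank_covers)

section \<open>Maximal chains and the length of a graded poset\<close>

lemma maximal_chain_iff:
  "maximal_chain L C \<longleftrightarrow> C \<subseteq> carrier L \<and> (\<forall>x\<in>C. \<forall>y\<in>C. x \<sqsubseteq> y \<or> y \<sqsubseteq> x) \<and>
    (\<forall>z\<in>carrier L. (\<forall>x\<in>C. x \<sqsubseteq> z \<or> z \<sqsubseteq> x) \<longrightarrow> z \<in> C)" (is "?l \<longleftrightarrow> ?r")
proof
  have chain: "pred_on.chain (carrier L) (\<sqsubseteq>) D \<longleftrightarrow> D \<subseteq> carrier L \<and> (\<forall>x\<in>D. \<forall>y\<in>D. x \<sqsubseteq> y \<or> y \<sqsubseteq> x)" for D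
    by (auto simp: pred_on.chain_def) (metis le_refl subsetD)
  {
    assume l: ?l
    have "z \<in> C" if z: "z \<in> carrier L" "\<forall>x\<in>C. x \<sqsubseteq> z \<or> z \<sqsubseteq> x" for z
    proof (rule ccontr)
      assume "z \<notin> C"
      then have "C \<subset> insert z C"
        by auto
      moreover have "pred_on.chain (carrier L) (\<sqsubseteq>) (insert z C)"
        using l z le_refl unfolding maximal_chain_def pred_on.maxchain_def chain by auto
      ultimately show False
        using l unfolding maximal_chain_def pred_on.maxchain_def by blast
    qed
    then show ?r
      using l unfolding maximal_chain_def pred_on.maxchain_def chain by blast
  }
  {
    assume r: ?r
    then show ?l
      unfolding maximal_chain_def pred_on.maxchain_def chain by (meson psubsetE subset_iff)
  }
qed

text \<open>On a chain \<open>\<rho>\<close> is strictly increasing, hence injective. By maximality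
  the next element of the chain is a cover in the whole poset, so no value between
  \<open>\<rho> b\<close> and \<open>\<rho> t\<close> is skipped.\<close>

lemma card_maximal_chain:
  assumes "maximal_chain L C"
  shows "card C = Suc (\<rho> t - \<rho> b)"
proof -
  have C: "C \<subseteq> carrier L" "\<And>x y. x \<in> C \<Longrightarrow> y \<in> C \<Longrightarrow> x \<sqsubseteq> y \<or> y \<sqsubseteq> x"
    and max: "\<And>z. z \<in> carrier L \<Longrightarrow> (\<And>x. x \<in> C \<Longrightarrow> x \<sqsubseteq> z \<or> z \<sqsubseteq> x) \<Longrightarrow> z \<in> C"
    using assms unfolding maximal_chain_iff by blast+
  have less: "\<rho> x < \<rho> y" if "x \<in> C" "y \<in> C" "x \<sqsubseteq> y" "x \<noteq> y" for x y
    using rank_less[of x y] that subsetD[OF C(1)] lless_eq[of x y] by simp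
  have inj: "inj_on \<rho> C"
  proof (rule inj_onI, rule ccontr)
    fix x y
    assume "x \<in> C" "y \<in> C" "\<rho> x = \<rho> y" "x \<noteq> y"
    then show False
      using less[of x y] less[of y x] C(2)[of x y] by auto
  qed
  have bC: "b \<in> C"
    by (rule max[OF b_closed]) (use b_le C(1) in auto)
  have tC: "t \<in> C"
    by (rule max[OF t_closed]) (use le_t C(1) in auto)
  have "\<rho> b + i \<in> \<rho> ` C" if "\<rho> b + i \<le> \<rho> t" for i
    using that
  proof (induction i)
    case 0
    then show ?case
      using bC by auto
  next
    case (Suc i)
    then obtain x where x: "x \<in> C" "\<rho> x = \<rho> b + i"
      by force
    then have "x \<noteq> t"
      using Suc.prems by auto
    then have "t \<in> {y \<in> C. x \<sqsubseteq> y \<and> x \<noteq> y}"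
      using tC le_t x C(1) by auto
    then obtain y where y: "y \<in> C" "x \<sqsubseteq> y" "x \<noteq> y"
      and ymin: "\<And>w. w \<in> C \<Longrightarrow> x \<sqsubseteq> w \<Longrightarrow> x \<noteq> w \<Longrightarrow> \<rho> y \<le> \<rho> w"
      using ex_has_least_nat[of "\<lambda>y. y \<in> {y \<in> C. x \<sqsubseteq> y \<and> x \<noteq> y}" t \<rho>] by blast
    have "covers L y x"
      unfolding covers_def
    proof (intro conjI notI)
      assume "\<exists>z\<in>carrier L. x \<sqsubset> z \<and> z \<sqsubset> y"
      then obtain z where z: "z \<in> carrier L" "x \<sqsubseteq> z" "x \<noteq> z" "z \<sqsubseteq> y" "z \<noteq> y"
        by (auto simp: lless_eq)
      have "w \<sqsubseteq> z \<or> z \<sqsubseteq> w" if w: "w \<in> C" for w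
      proof (cases "w \<sqsubseteq> x")
        case True
        then show ?thesis
          using z le_trans[of w x z] w x C(1) by auto
      next
        case False
        then have xw: "x \<sqsubseteq> w" "x \<noteq> w"
          using C(2)[OF x(1) w] le_refl[of x] x(1) C(1) by auto
        have "y \<sqsubseteq> w"
          using ymin[OF w xw] C(2)[OF y(1) w] less[of w y] w y(1) C(1) le_refl[of y] by auto
        then show ?thesis
          using z le_trans[of z y w] w y C(1) by auto
      qed
      then have "z \<in> C"
        using max z(1) by simp
      then show False
        using ymin[of z] less[of z y] y(1) z by auto
    qed (use x y C(1) in \<open>auto simp: lless_eq\<close>)
    then have "\<rho> y = \<rho> b + Suc i"
      using rank_covers x by simp
    then show ?case
      using y by force
  qed
  then have "{\<rho> b..\<rho> t} \<subseteq> \<rho> ` C"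
    by (auto simp: le_iff_add)
  moreover have "\<rho> x \<in> {\<rho> b..\<rho> t}" if "x \<in> C" for x
    using that rank_le[of b x] rank_le[of x t] b_closed t_closed b_le le_t C(1) by auto
  ultimately have "\<rho> ` C = {\<rho> b..\<rho> t}"
    by blast
  moreover have "\<rho> b \<le> \<rho> t"
    using rank_le[OF b_closed t_closed] b_le t_closed by simp
  ultimately show ?thesis
    using card_image[OF inj] by simp
qed

lemma pure: "pure_poset L"
  unfolding pure_poset_def using finite_bounded card_maximal_chain by simp

lemma length_eq: "poset_length L = \<rho> t - \<rho> b"
proof -
  \<comment> \<open>Some maximal chain must exist for the description in \<open>poset_length\<close>
    to single out a number.\<close>
  obtain C where "maximal_chain L C"
    using pred_on.Hausdorff unfolding maximal_chain_def by blast
  then show ?thesis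
    unfolding poset_length_def using card_maximal_chain by (intro the_equality) force+
qed

section \<open>Intervals of a graded poset\<close>

lemma covers_interval:
  assumes "x \<in> carrier L" "y \<in> carrier L"
  shows "covers (interval_poset L x y) w v \<longleftrightarrow>
     covers L w v \<and> v \<in> carrier L \<and> w \<in> carrier L \<and> x \<sqsubseteq> v \<and> v \<sqsubseteq> y \<and> x \<sqsubseteq> w \<and> w \<sqsubseteq> y"
proof -
  let ?I = "interval_poset L x y"
  have less: "lless ?I = lless L"
    by (auto simp: lless_def interval_poset_def fun_eq_iff)
  have mem: "z \<in> carrier ?I \<longleftrightarrow> z \<in> carrier L \<and> x \<sqsubseteq> z \<and> z \<sqsubseteq> y" for z
    by (simp add: interval_poset_def at_least_at_most_def)
  \<comment> \<open>Intervals are convex, so whatever lies strictly between two of their members in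
    \<open>L\<close> is already in the interval.\<close>
  have "z \<in> carrier ?I" if "z \<in> carrier L" "v \<sqsubset> z" "z \<sqsubset> w" "v \<in> carrier ?I" "w \<in> carrier ?I" for z
    using that assms le_trans[of x v z] le_trans[of z w y] by (simp add: lless_eq mem)
  then have "covers ?I w v \<longleftrightarrow> covers L w v \<and> v \<in> carrier ?I \<and> w \<in> carrier ?I"
    unfolding covers_def less using mem by meson
  then show ?thesis
    using mem by auto
qed

lemma graded_interval:
  assumes "x \<in> carrier L" "y \<in> carrier L" "x \<sqsubseteq> y"
  shows "graded_poset (interval_poset L x y) \<rho> x y"
proof -
  have "weak_partial_order (interval_poset L x y)"
    unfolding interval_poset_def
    by (rule weak_partial_order_subset[OF weak_partial_order_axioms at_least_at_most_closed])
  then have "partial_order (interval_poset L x y)"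
    using eq_is_equal by (simp add: partial_order_def partial_order_axioms_def interval_poset_def)
  then show ?thesis
  proof (rule graded_poset.intro, unfold_locales)
    show "finite (carrier (interval_poset L x y))"
      using finite_carrier by (simp add: interval_poset_def at_least_at_most_def)
    show "least (interval_poset L x y) x (carrier (interval_poset L x y))"
      using assms by (auto simp: interval_poset_def at_least_at_most_def least_def)
    show "greatest (interval_poset L x y) y (carrier (interval_poset L x y))"
      using assms by (auto simp: interval_poset_def at_least_at_most_def greatest_def)
    show "\<rho> w = Suc (\<rho> v)" if "covers (interval_poset L x y) w v" for v w
      using that assms covers_interval rank_covers by blast
  qed
qed

end

text \<open>If every atom ordering of the upper intervals is recursive, the ones required there can be
  obtained by listing any prescribed subset of the atoms first.\<close>

lemma (in graded_poset) recursive_atom_orderingI: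
  assumes as: "distinct as" "set as = atoms L"
    and interval: "\<And>a bs. covers L a b \<Longrightarrow> poset_length L > 1 \<Longrightarrow> distinct bs \<Longrightarrow>
       set bs = atoms (interval_poset L a t) \<Longrightarrow> recursive_atom_ordering (interval_poset L a t) bs"
    and exchange: "\<And>i j y. i < j \<Longrightarrow> j < length as \<Longrightarrow> y \<in> carrier L \<Longrightarrow> as ! i \<sqsubset> y \<Longrightarrow> as ! j \<sqsubset> y \<Longrightarrow>
       \<exists>k<j. \<exists>z\<in>carrier L. z \<sqsubseteq> y \<and> covers L z (as ! j) \<and> as ! k \<sqsubset> z"
  shows "recursive_atom_ordering L as"
proof (cases "poset_length L \<le> 1")
  case True
  then show ?thesis
    using pure as by (intro recursive_atom_ordering.short)
next
  case False
  show ?thesis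
  proof (rule recursive_atom_ordering.long)
    show "1 < poset_length L"
      using False by simp
    show "\<forall>j<length as. \<exists>bs. recursive_atom_ordering (interval_poset L (as ! j) \<top>) bs \<and>
           (\<forall>p q. p < q \<longrightarrow> q < length bs \<longrightarrow>
              (\<exists>i<j. bs ! q \<in> \<lbrace>as ! i..\<top>\<rbrace>) \<longrightarrow> (\<exists>i<j. bs ! p \<in> \<lbrace>as ! i..\<top>\<rbrace>))"
    proof (intro allI impI)
      fix j
      assume "j < length as"
      then have a: "covers L (as ! j) b"
        using as(2) nth_mem by (fastforce simp: atoms_def bottom_eq_b)
      let ?I = "interval_poset L (as ! j) t" and ?P = "\<lambda>c. \<exists>i<j. c \<in> \<lbrace>as ! i..\<top>\<rbrace>"
      have "atoms ?I \<subseteq> carrier L"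
        by (auto simp: atoms_def covers_def interval_poset_def at_least_at_most_def)
      then obtain cs where cs: "distinct cs" "set cs = atoms ?I"
        using finite_distinct_list finite_subset finite_carrier by metis
      define f g where "f = filter ?P cs" and "g = filter (\<lambda>c. \<not> ?P c) cs"
      define bs where "bs = f @ g"
      have bs: "distinct bs" "set bs = atoms ?I"
        using cs by (auto simp: bs_def f_def g_def)
      have f: "?P c" if "c \<in> set f" for c
        using that by (auto simp: f_def)
      have g: "\<not> ?P c" if "c \<in> set g" for c
        using that by (auto simp: g_def)
      have "recursive_atom_ordering ?I bs"
        using interval a False bs by simp
      moreover have "?P (bs ! p)" if pq: "p < q" "q < length bs" "?P (bs ! q)" for p q
      proof -
        have "q < length f"
        proof (rule ccontr)
          assume "\<not> q < length f"
          then have "bs ! q = g ! (q - length f)" "q - length f < length g"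
            using pq(2) by (auto simp: bs_def nth_append)
          then show False
            using pq(3) g nth_mem by metis
        qed
        then have "bs ! p = f ! p" "p < length f"
          using pq(1) by (auto simp: bs_def nth_append)
        then show ?thesis
          using f nth_mem by metis
      qed
      ultimately show "\<exists>bs. recursive_atom_ordering (interval_poset L (as ! j) \<top>) bs \<and>
        (\<forall>p q. p < q \<longrightarrow> q < length bs \<longrightarrow> ?P (bs ! q) \<longrightarrow> ?P (bs ! p))"
        unfolding top_eq_t by blast
    qed
  qed (use pure as exchange in auto)
qed

text \<open>Phrased with an upper bound \<open>y\<close> instead of a join, so that no semilattice
  is presupposed and the conclusion is the exchange condition with \<open>k = i\<close>.\<close>

definition upper_semimodular :: "'a gorder \<Rightarrow> bool" where
  "upper_semimodular L \<longleftrightarrow> (\<forall>u v w y. covers L v u \<longrightarrow> covers L w u \<longrightarrow> v \<noteq> w \<longrightarrow>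
     y \<in> carrier L \<longrightarrow> v \<sqsubseteq>\<^bsub>L\<^esub> y \<longrightarrow> w \<sqsubseteq>\<^bsub>L\<^esub> y \<longrightarrow>
     (\<exists>t. covers L t v \<and> t \<sqsubseteq>\<^bsub>L\<^esub> y \<and> w \<sqsubset>\<^bsub>L\<^esub> t))"

lemma (in graded_poset) upper_semimodular_interval:
  assumes "upper_semimodular L" "x \<in> carrier L" "y \<in> carrier L"
  shows "upper_semimodular (interval_poset L x y)"
  unfolding upper_semimodular_def
proof (intro allI impI)
  let ?I = "interval_poset L x y"
  fix u v w z
  assume vw: "covers ?I v u" "covers ?I w u" "v \<noteq> w" and z: "z \<in> carrier ?I" "v \<sqsubseteq>\<^bsub>?I\<^esub> z" "w \<sqsubseteq>\<^bsub>?I\<^esub> z"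
  note c = covers_interval[OF assms(2,3)]
  have z': "z \<in> carrier L" "z \<sqsubseteq> y" "v \<sqsubseteq> z" "w \<sqsubseteq> z"
    using z by (auto simp: interval_poset_def at_least_at_most_def)
  then obtain s where s: "covers L s v" "s \<sqsubseteq> z" "w \<sqsubset> s"
    using assms(1) vw z' unfolding upper_semimodular_def c by blast
  then have "s \<in> carrier L" "v \<sqsubseteq> s"
    by (auto simp: covers_def lless_eq)
  then have "covers ?I s v"
    using s vw z' assms le_trans unfolding c by blast
  then show "\<exists>t. covers ?I t v \<and> t \<sqsubseteq>\<^bsub>?I\<^esub> z \<and> w \<sqsubset>\<^bsub>?I\<^esub> t"
    using s by (auto simp: interval_poset_def lless_def)
qed

text \<open>Since \<open>k = i\<close> always serves, the order of the atoms is irrelevant. Upper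
  intervals inherit semimodularity and are shorter, so the induction runs on the length, for all
  atom orderings at once.\<close>

lemma recursive_atom_ordering_semimodular:
  assumes "graded_poset L \<rho> b t" "upper_semimodular L" "distinct as" "set as = atoms L"
  shows "recursive_atom_ordering L as"
  using assms
proof (induction "\<rho> t - \<rho> b" arbitrary: L b as rule: less_induct)
  case less
  interpret graded_poset L \<rho> b t
    by fact
  show ?case
  proof (rule recursive_atom_orderingI)
    fix a bs
    assume a: "covers L a b" and bs: "distinct bs" "set bs = atoms (interval_poset L a t)"
      and len: "poset_length L > 1"
    then have "a \<in> carrier L" "\<rho> t - \<rho> a < \<rho> t - \<rho> b"
      using rank_covers length_eq by (auto simp: covers_def)
    then show "recursive_atom_ordering (interval_poset L a t) bs"
      using less.hyps less.prems(2) bs graded_interval t_closed le_t upper_semimodular_interval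
      by blast
  next
    fix i j y
    assume ij: "i < j" "j < length as" and y: "y \<in> carrier L" "as ! i \<sqsubset>\<^bsub>L\<^esub> y" "as ! j \<sqsubset>\<^bsub>L\<^esub> y"
    have "as ! i \<noteq> as ! j" "as ! i \<in> atoms L" "as ! j \<in> atoms L"
      using ij less.prems(3,4) nth_eq_iff_index_eq nth_mem by fastforce+
    then obtain z where "covers L z (as ! j)" "z \<sqsubseteq>\<^bsub>L\<^esub> y" "as ! i \<sqsubset>\<^bsub>L\<^esub> z"
      using less.prems(2) y unfolding upper_semimodular_def atoms_def by (metis lless_eq mem_Collect_eq)
    then show "\<exists>k<j. \<exists>z\<in>carrier L. z \<sqsubseteq>\<^bsub>L\<^esub> y \<and> covers L z (as ! j) \<and> as ! k \<sqsubset>\<^bsub>L\<^esub> z"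
      using ij by (auto simp: covers_def)
  qed (use less.prems in auto)
qed

section \<open>Transversals\<close>

lemma dowling_act_simp [simp]: "dowling_act G g (h, m) = (g \<otimes>\<^bsub>G\<^esub> h, m)"
  by (simp add: dowling_act_def)

lemma snd_dowling_act [simp]: "snd (dowling_act G g x) = snd x"
  by (cases x) simp

lemma snd_image_dowling_act [simp]: "snd ` dowling_act G g ` K = snd ` K"
  by (simp add: image_image)

locale dowling = group G for G :: "('g, 'b) monoid_scheme" (structure) +
  fixes n :: nat
  assumes finite_carrier: "finite (carrier G)"
begin

abbreviation X where "X \<equiv> dowling_ground G n"
abbreviation act where "act \<equiv> dowling_act G"
abbreviation Q where "Q \<equiv> dowling_carrier G n"

lemma finite_X: "finite X"
  using finite_carrier by (simp add: dowling_ground_def)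

lemma act_closed [simp]: "g \<in> carrier G \<Longrightarrow> x \<in> X \<Longrightarrow> act g x \<in> X"
  by (auto simp: dowling_ground_def)

lemma act_act: "g \<in> carrier G \<Longrightarrow> h \<in> carrier G \<Longrightarrow> x \<in> X \<Longrightarrow> act g (act h x) = act (g \<otimes> h) x"
  by (auto simp: dowling_ground_def m_assoc)

lemma act_one [simp]: "x \<in> X \<Longrightarrow> act \<one> x = x"
  by (auto simp: dowling_ground_def)

lemma act_image_image:
  "g \<in> carrier G \<Longrightarrow> h \<in> carrier G \<Longrightarrow> K \<subseteq> X \<Longrightarrow> act g ` act h ` K = act (g \<otimes> h) ` K"
  unfolding image_image by (rule image_cong[OF refl]) (blast intro: act_act)

lemma act_image_one: "K \<subseteq> X \<Longrightarrow> act \<one> ` K = K"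
  using image_cong[of K K "act \<one>" "\<lambda>x. x"] act_one by blast

lemma act_eq_iff: "g \<in> carrier G \<Longrightarrow> h \<in> carrier G \<Longrightarrow> x \<in> X \<Longrightarrow> act g x = act h x \<longleftrightarrow> g = h"
  by (auto simp: dowling_ground_def)

lemma act_transitive:
  assumes "x \<in> X" "y \<in> X" "snd x = snd y"
  obtains g where "g \<in> carrier G" "y = act g x"
proof -
  have "fst y \<otimes> inv (fst x) \<in> carrier G" "y = act (fst y \<otimes> inv (fst x)) x"
    using assms by (auto simp: dowling_ground_def m_assoc)
  then show thesis
    using that by blast
qed

lemma finite_Q: "finite Q"
proof (rule finite_subset)
  show "Q \<subseteq> Pow X \<times> Pow (Pow X)"
    by (auto simp: dowling_carrier_def partition_on_def)
  show "finite (Pow X \<times> Pow (Pow X))"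
    using finite_X by simp
qed

text \<open>The group acts simply transitively on each column. One point per column in the whole
  union is therefore what makes all translates of all blocks distinct and disjoint.\<close>

definition transversal :: "('g \<times> nat) set set \<Rightarrow> bool" where
  "transversal R \<longleftrightarrow> {} \<notin> R \<and> \<Union>R \<subseteq> X \<and> disjoint R \<and> inj_on snd (\<Union>R)"

definition mk :: "('g \<times> nat) set set \<Rightarrow> 'g dowling" where
  "mk R = ({x \<in> X. snd x \<notin> snd ` \<Union>R}, {act g ` K |g K. g \<in> carrier G \<and> K \<in> R})"

lemma transversal_subset: "transversal R \<Longrightarrow> R' \<subseteq> R \<Longrightarrow> transversal R'"
  unfolding transversal_def
  by (meson Union_mono disjoint_def inj_on_subset order_trans subsetD)

lemma transversal_finite: "transversal R \<Longrightarrow> finite R"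
  using finite_X by (auto simp: transversal_def intro: finite_subset finite_UnionD)

lemma transversal_block_eq:
  assumes "transversal R" "K \<in> R" "K' \<in> R" "k \<in> K" "k' \<in> K'" "snd k = snd k'"
  shows "K = K' \<and> k = k'"
proof -
  have "k = k'"
    using assms by (auto simp: transversal_def inj_on_def)
  then show ?thesis
    using assms by (auto simp: transversal_def disjoint_def)
qed

lemma transversal_translate_eq:
  assumes R: "transversal R" "K \<in> R" "K' \<in> R" and g: "g \<in> carrier G" "h \<in> carrier G"
    and x: "x \<in> act g ` K" "x \<in> act h ` K'"
  shows "g = h \<and> K = K'"
proof -
  obtain k k' where k: "k \<in> K" "k' \<in> K'" "x = act g k" "x = act h k'"
    using x by auto
  then have "K = K' \<and> k = k'"
    using transversal_block_eq[OF R, of k k'] by (metis snd_dowling_act)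
  moreover have "k \<in> X"
    using R k by (auto simp: transversal_def)
  ultimately show ?thesis
    using k act_eq_iff[of g h k] g by auto
qed

lemma mk_in_Q:
  assumes R: "transversal R"
  shows "mk R \<in> Q"
proof -
  have sub: "K \<subseteq> X" "K \<noteq> {}" if "K \<in> R" for K
    using R that by (auto simp: transversal_def)
  let ?J = "fst (mk R)" and ?P = "snd (mk R)"
  have "\<Union>?P = X - ?J"
  proof
    show "\<Union>?P \<subseteq> X - ?J"
    proof
      fix x
      assume "x \<in> \<Union>?P"
      then obtain g K k where "g \<in> carrier G" "K \<in> R" "k \<in> K" "x = act g k"
        by (auto simp: mk_def)
      then show "x \<in> X - ?J"
        using sub[of K] by (auto simp: mk_def)
    qed
    show "X - ?J \<subseteq> \<Union>?P"
    proof
      fix x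
      assume "x \<in> X - ?J"
      then obtain k K where k: "K \<in> R" "k \<in> K" "snd k = snd x" "x \<in> X"
        by (auto simp: mk_def)
      moreover obtain g where "g \<in> carrier G" "x = act g k"
        using act_transitive[of k x] k sub by auto
      ultimately show "x \<in> \<Union>?P"
        by (auto simp: mk_def)
    qed
  qed
  moreover have "disjoint ?P"
  proof (rule disjointI, rule ccontr)
    fix L L'
    assume L: "L \<in> ?P" "L' \<in> ?P" "L \<noteq> L'" "L \<inter> L' \<noteq> {}"
    then obtain g K h K' where "g \<in> carrier G" "K \<in> R" "L = act g ` K"
      "h \<in> carrier G" "K' \<in> R" "L' = act h ` K'"
      by (auto simp: mk_def)
    moreover obtain x where "x \<in> L" "x \<in> L'"
      using L(4) by blast
    ultimately show False
      using transversal_translate_eq[OF R, of K K' g h x] L(3) by auto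
  qed
  moreover have "{} \<notin> ?P"
    using sub by (auto simp: mk_def)
  ultimately have part: "partition_on (X - ?J) ?P"
    by (auto simp: partition_on_def)
  have free: "act g ` L \<noteq> L \<and> act g ` L \<in> ?P" if g: "g \<in> carrier G" "g \<noteq> \<one>" and L: "L \<in> ?P" for g L
  proof -
    obtain h K where L: "L = act h ` K" "h \<in> carrier G" "K \<in> R"
      using L by (auto simp: mk_def)
    then have gL: "act g ` L = act (g \<otimes> h) ` K"
      using act_image_image g sub by simp
    obtain k where "k \<in> K"
      using sub(2)[OF L(3)] by blast
    have "g \<otimes> h \<noteq> h"
      using g L by (simp add: r_cancel_one)
    then have "act (g \<otimes> h) k \<notin> act h ` K"
      using transversal_translate_eq[OF R L(3,3), of "g \<otimes> h" h] g L \<open>k \<in> K\<close> by blast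
    then show ?thesis
      unfolding gL using L g \<open>k \<in> K\<close> by (auto simp: mk_def)
  qed
  moreover have "act g ` ?J \<subseteq> ?J" if "g \<in> carrier G" for g
  proof (rule image_subsetI)
    fix x
    assume "x \<in> ?J"
    then have "x \<in> X" "snd (act g x) \<notin> snd ` \<Union>R"
      by (simp_all add: mk_def)
    then show "act g x \<in> ?J"
      using that unfolding mk_def by (simp only: fst_conv mem_Collect_eq act_closed simp_thms)
  qed
  moreover have "?J \<subseteq> X"
    by (auto simp: mk_def)
  ultimately have "(?J, ?P) \<in> Q"
    unfolding dowling_carrier_def mem_Collect_eq case_prod_conv using part by simp
  then show ?thesis
    by simp
qed

text \<open>Freeness makes the pairs of a group element and a representative correspond bijectively
  to the parts. The constant summand counts parts; \<open>block_weight\<close> is the other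
  invariant to which this is applied.\<close>

lemma sum_mk:
  fixes F :: "('g \<times> nat) set \<Rightarrow> int"
  assumes R: "transversal R" and F: "\<And>g K. g \<in> carrier G \<Longrightarrow> K \<in> R \<Longrightarrow> F (act g ` K) = F K"
  shows "sum F (snd (mk R)) = int (order G) * sum F R"
proof -
  have "inj_on (\<lambda>(g, K). act g ` K) (carrier G \<times> R)"
  proof (rule inj_onI, clarify)
    fix g K h K'
    assume *: "g \<in> carrier G" "h \<in> carrier G" "K \<in> R" "K' \<in> R" "act g ` K = act h ` K'"
    then have "K \<noteq> {}"
      using R by (auto simp: transversal_def)
    then obtain k where "k \<in> K"
      by blast
    then show "g = h \<and> K = K'"
      using transversal_translate_eq[OF R, of K K' g h "act g k"] * by auto
  qed
  moreover have "snd (mk R) = (\<lambda>(g, K). act g ` K) ` (carrier G \<times> R)"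
    by (auto simp: mk_def)
  ultimately have "sum F (snd (mk R)) = (\<Sum>(g, K)\<in>carrier G \<times> R. F (act g ` K))"
    by (simp add: sum.reindex case_prod_unfold o_def)
  also have "\<dots> = (\<Sum>(g, K)\<in>carrier G \<times> R. F K)"
    by (rule sum.cong) (auto simp: F)
  also have "\<dots> = int (order G) * sum F R"
    by (simp add: sum.cartesian_product[symmetric] order_def)
  finally show ?thesis .
qed

lemma card_mk: "transversal R \<Longrightarrow> card (snd (mk R)) = order G * card R"
  using sum_mk[of R "\<lambda>_. 1"] by (simp flip: of_nat_mult)

lemma in_snd_mk: "transversal R \<Longrightarrow> K \<in> R \<Longrightarrow> K \<in> snd (mk R)"
proof -
  assume "transversal R" "K \<in> R"
  then have "K = act \<one> ` K"
    using act_image_one[of K] by (auto simp: transversal_def)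
  then show "K \<in> snd (mk R)"
    unfolding mk_def using \<open>K \<in> R\<close> by fastforce
qed

section \<open>Orbits of parts and their representatives\<close>

context
  fixes J \<pi>
  assumes in_Q: "(J, \<pi>) \<in> Q"
begin

lemma J_subset: "J \<subseteq> X"
  and partition: "partition_on (X - J) \<pi>"
  and act_J: "g \<in> carrier G \<Longrightarrow> x \<in> J \<Longrightarrow> act g x \<in> J"
  using in_Q by (auto simp: dowling_carrier_def)

lemma block_subset: "K \<in> \<pi> \<Longrightarrow> K \<subseteq> X"
  and block_nonempty: "K \<in> \<pi> \<Longrightarrow> K \<noteq> {}"
  and block_J: "K \<in> \<pi> \<Longrightarrow> x \<in> K \<Longrightarrow> x \<notin> J"
  and block_eq: "K \<in> \<pi> \<Longrightarrow> K' \<in> \<pi> \<Longrightarrow> x \<in> K \<Longrightarrow> x \<in> K' \<Longrightarrow> K = K'"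
  and ex_block: "x \<in> X \<Longrightarrow> x \<notin> J \<Longrightarrow> \<exists>K\<in>\<pi>. x \<in> K"
proof -
  have *: "\<Union>\<pi> = X - J" "{} \<notin> \<pi>" "disjoint \<pi>"
    using partition by (auto simp: partition_on_def)
  show "K \<in> \<pi> \<Longrightarrow> K \<subseteq> X" "K \<in> \<pi> \<Longrightarrow> x \<in> K \<Longrightarrow> x \<notin> J"
    "x \<in> X \<Longrightarrow> x \<notin> J \<Longrightarrow> \<exists>K\<in>\<pi>. x \<in> K"
    using *(1) by blast+
  show "K \<in> \<pi> \<Longrightarrow> K \<noteq> {}"
    using *(2) by blast
  show "K \<in> \<pi> \<Longrightarrow> K' \<in> \<pi> \<Longrightarrow> x \<in> K \<Longrightarrow> x \<in> K' \<Longrightarrow> K = K'"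
    using disjointD[OF *(3), of K K'] by blast
qed

lemma act_block: "g \<in> carrier G \<Longrightarrow> K \<in> \<pi> \<Longrightarrow> act g ` K \<in> \<pi>"
  using in_Q act_image_one[OF block_subset]
  by (cases "g = \<one>") (auto simp: dowling_carrier_def)

lemma act_block_eq: "g \<in> carrier G \<Longrightarrow> K \<in> \<pi> \<Longrightarrow> act g ` K = K \<Longrightarrow> g = \<one>"
  using in_Q by (auto simp: dowling_carrier_def simp del: image_subset_iff) (meson DiffI singletonD)

lemma in_J_snd:
  assumes "x \<in> J" "y \<in> X" "snd x = snd y"
  shows "y \<in> J"
proof -
  obtain g where "g \<in> carrier G" "y = act g x"
    using act_transitive[of x y] assms J_subset by blast
  then show ?thesis
    using act_J assms by simp
qed

text \<open>Transitivity on the common column carries \<open>x\<close> to \<open>x'\<close>, and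
  parts with a common point coincide. Hence different orbits of parts occupy disjoint sets of
  columns.\<close>

lemma block_translate:
  assumes "K \<in> \<pi>" "K' \<in> \<pi>" "x \<in> K" "x' \<in> K'" "snd x = snd x'"
  obtains g where "g \<in> carrier G" "K' = act g ` K" "x' = act g x"
proof -
  obtain g where g: "g \<in> carrier G" "x' = act g x"
    using act_transitive[of x x'] assms block_subset by blast
  have "K' = act g ` K"
    by (rule block_eq[of _ _ x']) (use g assms act_block in auto)
  then show thesis
    using that g by blast
qed

text \<open>A group element moving one point of \<open>K\<close> to another one in the same column
  would stabilise \<open>K\<close>, so by freeness it is the identity.\<close>

lemma block_inj:
  assumes "K \<in> \<pi>"
  shows "inj_on snd K"
proof (rule inj_onI)
  fix x y
  assume *: "x \<in> K" "y \<in> K" "snd x = snd y"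
  obtain g where g: "g \<in> carrier G" "K = act g ` K" "y = act g x"
    using block_translate[OF assms assms *] by blast
  then have "g = \<one>"
    using act_block_eq assms by simp
  then show "x = y"
    using g(3) * act_one[of x] block_subset[OF assms] by auto
qed

lemma transversal_single: "K \<in> \<pi> \<Longrightarrow> transversal {K}"
  using block_inj block_subset block_nonempty by (auto simp: transversal_def)

lemma transversal_pair:
  assumes "K \<in> \<pi>" "K' \<in> \<pi>" "\<And>g. g \<in> carrier G \<Longrightarrow> K' \<noteq> act g ` K"
  shows "transversal {K, K'}" "K \<noteq> K'"
proof -
  have ne: "snd x \<noteq> snd x'" if "x \<in> K" "x' \<in> K'" for x x'
    using block_translate[OF assms(1,2) that] assms(3) by blast
  then have "K \<inter> K' = {}"
    by blast
  moreover have "inj_on snd (K \<union> K')"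
    using ne block_inj assms(1,2) unfolding inj_on_Un by fastforce
  ultimately show "transversal {K, K'}"
    using block_subset block_nonempty assms(1,2)
    by (auto simp: transversal_def disjoint_def)
  show "K \<noteq> K'"
    using assms(3)[of \<one>] act_image_one block_subset[OF assms(1)] by auto
qed

text \<open>Prescribing \<open>R0\<close> keeps control of one or two given parts while
  representatives of the remaining orbits are chosen. A maximal transversal family of parts meets
  every orbit, because a part of a missed orbit uses only columns that are still unoccupied.\<close>

lemma ex_transversal:
  assumes "transversal R0" "R0 \<subseteq> \<pi>"
  obtains R where "transversal R" "R0 \<subseteq> R" "R \<subseteq> \<pi>" "(J, \<pi>) = mk R"
proof -
  have "finite \<pi>"
    using partition finite_X by (meson finite_Diff finite_elements)
  then have fin: "finite {R. R \<subseteq> \<pi> \<and> transversal R}"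
    by simp
  obtain R where R: "R0 \<subseteq> R" "R \<subseteq> \<pi>" "transversal R"
    and max: "\<And>R'. R \<subseteq> R' \<Longrightarrow> R' \<subseteq> \<pi> \<Longrightarrow> transversal R' \<Longrightarrow> R = R'"
    using finite_has_maximal2[OF fin, of R0] assms by auto
  have ex: "\<exists>K'\<in>R. \<exists>g\<in>carrier G. K = act g ` K'" if K: "K \<in> \<pi>" for K
  proof (rule ccontr)
    assume no: "\<not> ?thesis"
    have ne: "snd x \<noteq> snd y" if "K' \<in> R" "x \<in> K'" "y \<in> K" for K' x y
      using block_translate[of K' K x y] that R K no by blast
    have "transversal (insert K R)"
    proof -
      have "inj_on snd (K \<union> \<Union>R)"
        using ne R(3) block_inj[OF K] unfolding transversal_def inj_on_Un by fastforce
      moreover have "disjoint (insert K R)"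
        using ne R(3) unfolding transversal_def disjoint_def by blast
      ultimately show ?thesis
        using R(3) block_nonempty[OF K] block_subset[OF K] by (auto simp: transversal_def)
    qed
    then have "K \<in> R"
      using max[of "insert K R"] K R by auto
    then show False
      using no act_image_one[OF block_subset[OF K]] by force
  qed
  have "\<pi> = snd (mk R)"
  proof
    show "\<pi> \<subseteq> snd (mk R)"
      using ex by (fastforce simp: mk_def)
    show "snd (mk R) \<subseteq> \<pi>"
      using act_block R(2) by (auto simp: mk_def)
  qed
  \<comment> \<open>The parts determine \<open>J\<close> as the complement of their union.\<close>
  moreover have "J = fst (mk R)"
  proof -
    have "partition_on (X - fst (mk R)) (snd (mk R))"
      using mk_in_Q[OF R(3)] by (cases "mk R") (auto simp: dowling_carrier_def)
    then have "X - fst (mk R) = X - J"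
      using partition calculation by (simp add: partition_on_def)
    moreover have "fst (mk R) \<subseteq> X"
      by (auto simp: mk_def)
    ultimately show ?thesis
      using J_subset by auto
  qed
  ultimately show thesis
    using that R by auto
qed

end

end

section \<open>Order and closure\<close>

text \<open>The elementary constraints satisfied by an element: \<open>(x, None)\<close> stands for ``\<open>x\<close> lies in
  the \<open>J\<close>-part'' and \<open>(x, Some y)\<close> for ``\<open>x\<close> and \<open>y\<close> lie together in the \<open>J\<close>-part or in a block''.
  They determine the order, and every single constraint can be imposed in a least way.\<close>

definition constraints :: "'g dowling \<Rightarrow> (('g \<times> nat) \<times> ('g \<times> nat) option) set" where
  "constraints u = {(x, None) |x. x \<in> fst u} \<union>
     {(x, Some y) |x y. x \<in> fst u \<and> y \<in> fst u \<or> (\<exists>K\<in>snd u. x \<in> K \<and> y \<in> K)}"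

lemma constraints_None [simp]: "(x, None) \<in> constraints (J, \<pi>) \<longleftrightarrow> x \<in> J"
  and constraints_Some [simp]: "(x, Some y) \<in> constraints (J, \<pi>) \<longleftrightarrow>
    x \<in> J \<and> y \<in> J \<or> (\<exists>K\<in>\<pi>. x \<in> K \<and> y \<in> K)"
  unfolding constraints_def fst_conv snd_conv by blast+

lemma dowling_le_iff [simp]: "dowling_le (J, \<pi>) (J', \<pi>') \<longleftrightarrow>
    J \<subseteq> J' \<and> (\<forall>K\<in>\<pi>. K \<subseteq> J' \<or> (\<exists>K'\<in>\<pi>'. K \<subseteq> K'))"
  by (simp add: dowling_le_def)

context dowling
begin

text \<open>Once the order is inclusion of constraint sets, transitivity is free and joins arise by
  imposing constraints one at a time.\<close>

lemma le_iff_constraints: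
  assumes u: "(J, \<pi>) \<in> Q" and v: "(J', \<pi>') \<in> Q"
  shows "dowling_le (J, \<pi>) (J', \<pi>') \<longleftrightarrow> constraints (J, \<pi>) \<subseteq> constraints (J', \<pi>')"
proof
  assume le: "dowling_le (J, \<pi>) (J', \<pi>')"
  then have K: "K \<subseteq> J' \<or> (\<exists>K'\<in>\<pi>'. K \<subseteq> K')" if "K \<in> \<pi>" for K
    using that by auto
  have "J \<subseteq> J'"
    using le by simp
  have both: "x \<in> J' \<and> y \<in> J' \<or> (\<exists>K\<in>\<pi>'. x \<in> K \<and> y \<in> K)"
    if "K \<in> \<pi>" "x \<in> K" "y \<in> K" for x y K
    using K[OF that(1)] that(2,3) by blast
  have "(x, q) \<in> constraints (J', \<pi>')" if "(x, q) \<in> constraints (J, \<pi>)" for x q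
  proof (cases q)
    case None
    then show ?thesis
      using that \<open>J \<subseteq> J'\<close> by auto
  next
    case (Some y)
    then have "x \<in> J \<and> y \<in> J \<or> (\<exists>K\<in>\<pi>. x \<in> K \<and> y \<in> K)"
      using that by simp
    then have "x \<in> J' \<and> y \<in> J' \<or> (\<exists>K\<in>\<pi>'. x \<in> K \<and> y \<in> K)"
      using both \<open>J \<subseteq> J'\<close> by blast
    then show ?thesis
      using Some by simp
  qed
  then show "constraints (J, \<pi>) \<subseteq> constraints (J', \<pi>')"
    by (rule subrelI)
next
  assume sub: "constraints (J, \<pi>) \<subseteq> constraints (J', \<pi>')"
  have "J \<subseteq> J'"
    using sub constraints_None by blast
  moreover have "K \<subseteq> J' \<or> (\<exists>K'\<in>\<pi>'. K \<subseteq> K')" if K: "K \<in> \<pi>" for K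
  proof -
    obtain x where x: "x \<in> K"
      using block_nonempty[OF u K] by blast
    \<comment> \<open>The fixed point \<open>x\<close> decides: every other point of
      \<open>K\<close> is tied to it and follows it into \<open>J'\<close> or into its part.\<close>
    have both: "x \<in> J' \<and> y \<in> J' \<or> (\<exists>K\<in>\<pi>'. x \<in> K \<and> y \<in> K)" if "y \<in> K" for y
    proof -
      have "(x, Some y) \<in> constraints (J, \<pi>)"
        using K x that by auto
      then show ?thesis
        using sub by (metis constraints_Some subsetD)
    qed
    show ?thesis
    proof (cases "x \<in> J'")
      case True
      then show ?thesis
        using both block_J[OF v] by blast
    next
      case False
      then obtain L where L: "L \<in> \<pi>'" "x \<in> L"
        using both x by blast
      have "y \<in> L" if "y \<in> K" for y
        using both[OF that] False block_eq[OF v] L by blast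
      then show ?thesis
        using L by blast
    qed
  qed
  ultimately show "dowling_le (J, \<pi>) (J', \<pi>')"
    by simp
qed

lemma le_refl: "dowling_le u u"
  by (cases u) auto

lemma le_trans:
  assumes "u \<in> Q" "v \<in> Q" "w \<in> Q" "dowling_le u v" "dowling_le v w"
  shows "dowling_le u w"
proof -
  obtain J \<pi> J' \<pi>' J'' \<pi>'' where *: "u = (J, \<pi>)" "v = (J', \<pi>')" "w = (J'', \<pi>'')"
    by (cases u; cases v; cases w)
  show ?thesis
    using assms(4,5) le_iff_constraints[of J \<pi> J' \<pi>'] le_iff_constraints[of J' \<pi>' J'' \<pi>'']
      le_iff_constraints[of J \<pi> J'' \<pi>''] assms(1-3) unfolding * by simp
qed

lemma le_antisym_blocks:
  assumes u: "(J, \<pi>) \<in> Q" and v: "(J', \<pi>') \<in> Q"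
    and le: "dowling_le (J, \<pi>) (J', \<pi>')" "dowling_le (J', \<pi>') (J, \<pi>)"
  shows "\<pi> \<subseteq> \<pi>'"
proof
  fix K
  assume K: "K \<in> \<pi>"
  obtain x where x: "x \<in> K"
    using block_nonempty[OF u K] by blast
  have J: "J = J'"
    using le by auto
  have "x \<notin> J"
    using block_J[OF u K x] .
  then obtain K' where K': "K' \<in> \<pi>'" "K \<subseteq> K'"
    using le(1) K x J by auto
  then obtain K'' where K'': "K'' \<in> \<pi>" "K' \<subseteq> K''"
    using le(2) x J \<open>x \<notin> J\<close> unfolding dowling_le_iff by blast
  then have "K'' = K"
    using block_eq[OF u K''(1) K, of x] K' x by blast
  then show "K \<in> \<pi>'"
    using K' K'' by auto
qed

lemma le_antisym:
  assumes "u \<in> Q" "v \<in> Q" "dowling_le u v" "dowling_le v u"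
  shows "u = v"
proof -
  obtain J \<pi> J' \<pi>' where uv: "u = (J, \<pi>)" "v = (J', \<pi>')"
    by (cases u; cases v)
  have "\<pi> = \<pi>'"
    using le_antisym_blocks[of J \<pi> J' \<pi>'] le_antisym_blocks[of J' \<pi>' J \<pi>] assms uv by blast
  moreover have "J = J'"
    using assms uv by auto
  ultimately show ?thesis
    using uv by simp
qed

section \<open>Deleting and merging representatives\<close>

lemma mk_leI:
  assumes R: "transversal R" and v: "(J, \<pi>) \<in> Q"
    and J: "fst (mk R) \<subseteq> J" and K: "\<And>K. K \<in> R \<Longrightarrow> K \<subseteq> J \<or> (\<exists>L\<in>\<pi>. K \<subseteq> L)"
  shows "dowling_le (mk R) (J, \<pi>)"
proof -
  have "K' \<subseteq> J \<or> (\<exists>L\<in>\<pi>. K' \<subseteq> L)" if K': "K' \<in> snd (mk R)" for K'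
  proof -
    obtain g K0 where g: "K' = act g ` K0" "g \<in> carrier G" "K0 \<in> R"
      using K' by (auto simp: mk_def)
    show ?thesis
    proof (cases "K0 \<subseteq> J")
      case True
      then show ?thesis
        using g act_J[OF v] by auto
    next
      case False
      then obtain L where "L \<in> \<pi>" "K0 \<subseteq> L"
        using K g by blast
      then show ?thesis
        using g act_block[OF v, of g L] by blast
    qed
  qed
  then show ?thesis
    using J by (cases "mk R") auto
qed

lemma le_block:
  assumes "dowling_le (mk R) (J, \<pi>)" "transversal R" "K \<in> R"
  shows "K \<subseteq> J \<or> (\<exists>L\<in>\<pi>. K \<subseteq> L)"
  using assms(1) in_snd_mk[OF assms(2,3)] by (cases "mk R") simp

text \<open>Deleting a representative hands its columns over to the \<open>J\<close>-part. Nothing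
  smaller will do: a larger element whose \<open>J\<close>-part contains one point of
  \<open>K\<close> contains all of \<open>K\<close> there, and by stability under the group all
  columns that \<open>K\<close> meets.\<close>

lemma mk_remove_least:
  assumes R: "transversal R" and K: "K \<in> R" and x: "x \<in> K"
  shows "dowling_le (mk R) (mk (R - {K}))" "x \<in> fst (mk (R - {K}))"
    and "(J, \<pi>) \<in> Q \<Longrightarrow> dowling_le (mk R) (J, \<pi>) \<Longrightarrow> x \<in> J \<Longrightarrow> dowling_le (mk (R - {K})) (J, \<pi>)"
proof -
  let ?R = "R - {K}"
  have R': "transversal ?R"
    using R transversal_subset by blast
  have K_sub: "K \<subseteq> fst (mk ?R)"
  proof
    fix k
    assume k: "k \<in> K"
    have "snd k \<noteq> snd k'" if "K' \<in> ?R" "k' \<in> K'" for K' k'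
      using transversal_block_eq[OF R K, of K' k k'] that k by blast
    then show "k \<in> fst (mk ?R)"
      using R K k unfolding mk_def transversal_def by auto
  qed
  then show "x \<in> fst (mk ?R)"
    using x by blast
  obtain J' \<pi>' where J': "mk ?R = (J', \<pi>')"
    by fastforce
  have "fst (mk R) \<subseteq> J'"
    using J' by (auto simp: mk_def)
  moreover have "K' \<subseteq> J' \<or> (\<exists>L\<in>\<pi>'. K' \<subseteq> L)" if "K' \<in> R" for K'
    using that in_snd_mk[OF R', of K'] K_sub J' by (cases "K' = K") auto
  ultimately show "dowling_le (mk R) (mk ?R)"
    using mk_leI[OF R, of J' \<pi>'] mk_in_Q[OF R'] J' by simp
  assume v: "(J, \<pi>) \<in> Q" and le: "dowling_le (mk R) (J, \<pi>)" and xJ: "x \<in> J"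
  have "K \<subseteq> J"
    using le_block[OF le R K] block_J[OF v] x xJ by blast
  have "fst (mk ?R) \<subseteq> J"
  proof
    fix z
    assume z: "z \<in> fst (mk ?R)"
    then have zX: "z \<in> X"
      by (simp add: mk_def)
    show "z \<in> J"
    proof (cases "z \<in> fst (mk R)")
      case True
      then show ?thesis
        using le by (cases "mk R") auto
    next
      case False
      then obtain K' k where "K' \<in> R" "k \<in> K'" "snd k = snd z"
        using zX unfolding mk_def fst_conv mem_Collect_eq by (metis UnionE imageE)
      moreover from this have "K' = K"
        using z imageI[of k "\<Union>(R - {K})" snd] by (auto simp: mk_def)
      ultimately show ?thesis
        using in_J_snd[OF v, of k z] zX \<open>K \<subseteq> J\<close> by auto
    qed
  qed
  then show "dowling_le (mk ?R) (J, \<pi>)"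
    using mk_leI[OF R' v] le_block[OF le R] by blast
qed

lemma transversal_merge:
  assumes R: "transversal R" and K: "K \<in> R" "K' \<in> R"
  shows "transversal (insert (K \<union> K') (R - {K, K'}))" "\<Union>(insert (K \<union> K') (R - {K, K'})) = \<Union>R"
proof -
  show eq: "\<Union>(insert (K \<union> K') (R - {K, K'})) = \<Union>R"
    using K by blast
  have "disjoint (insert (K \<union> K') (R - {K, K'}))"
    using R K unfolding transversal_def disjoint_def by blast
  then show "transversal (insert (K \<union> K') (R - {K, K'}))"
    using R K unfolding transversal_def eq by auto
qed

lemma card_transversal_merge:
  assumes R: "transversal R" and K: "K \<in> R" "K' \<in> R" "K \<noteq> K'"
  shows "K \<union> K' \<notin> R - {K, K'}" "card R = Suc (card (insert (K \<union> K') (R - {K, K'})))"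
proof -
  obtain x where x: "x \<in> K"
    using R K(1) unfolding transversal_def by (metis all_not_in_conv)
  show "K \<union> K' \<notin> R - {K, K'}"
    using transversal_block_eq[OF R K(1), of "K \<union> K'" x x] x by auto
  moreover have fin: "finite R"
    using transversal_finite[OF R] .
  moreover have "card R = Suc (Suc (card (R - {K} - {K'})))"
    using fin K card.remove[of R K] card.remove[of "R - {K}" K'] by simp
  moreover have "R - {K, K'} = R - {K} - {K'}"
    by blast
  ultimately show "card R = Suc (card (insert (K \<union> K') (R - {K, K'})))"
    by simp
qed

text \<open>One pair of points suffices, because above \<open>mk R\<close> each of \<open>K\<close>
  and \<open>K'\<close> stays together: relating \<open>x\<close> to \<open>x'\<close> relates all
  of \<open>K \<union> K'\<close>.\<close>

lemma mk_merge_least: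
  assumes R: "transversal R" and K: "K \<in> R" "K' \<in> R" and x: "x \<in> K" "x' \<in> K'"
  defines "R' \<equiv> insert (K \<union> K') (R - {K, K'})"
  shows "dowling_le (mk R) (mk R')"
    and "(J, \<pi>) \<in> Q \<Longrightarrow> dowling_le (mk R) (J, \<pi>) \<Longrightarrow> (x, Some x') \<in> constraints (J, \<pi>) \<Longrightarrow>
      dowling_le (mk R') (J, \<pi>)"
proof -
  have R': "transversal R'" and U: "\<Union>R' = \<Union>R"
    using transversal_merge[OF R K] by (simp_all add: R'_def)
  have fst: "fst (mk R') = fst (mk R)"
    unfolding mk_def U by simp
  obtain J' \<pi>' where J': "mk R' = (J', \<pi>')"
    by fastforce
  have "K'' \<subseteq> J' \<or> (\<exists>L\<in>\<pi>'. K'' \<subseteq> L)" if "K'' \<in> R" for K''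
  proof -
    have "\<exists>L\<in>R'. K'' \<subseteq> L"
      unfolding R'_def using that by (cases "K'' \<in> {K, K'}") blast+
    then obtain L where "L \<in> R'" "K'' \<subseteq> L"
      by blast
    then show ?thesis
      using in_snd_mk[OF R', of L] J' by auto
  qed
  then show "dowling_le (mk R) (mk R')"
    using mk_leI[OF R, of J' \<pi>'] mk_in_Q[OF R'] J' fst by simp
  assume v: "(J, \<pi>) \<in> Q" and le: "dowling_le (mk R) (J, \<pi>)" and "(x, Some x') \<in> constraints (J, \<pi>)"
  then have "x \<in> J \<and> x' \<in> J \<or> (\<exists>L\<in>\<pi>. x \<in> L \<and> x' \<in> L)"
    by simp
  then have "K \<union> K' \<subseteq> J \<or> (\<exists>L\<in>\<pi>. K \<union> K' \<subseteq> L)"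
  proof
    assume *: "x \<in> J \<and> x' \<in> J"
    then have "K \<subseteq> J" "K' \<subseteq> J"
      using le_block[OF le R K(1)] le_block[OF le R K(2)] block_J[OF v] x by blast+
    then show ?thesis
      by simp
  next
    assume "\<exists>L\<in>\<pi>. x \<in> L \<and> x' \<in> L"
    then obtain L where L: "L \<in> \<pi>" "x \<in> L" "x' \<in> L"
      by blast
    then have "x \<notin> J" "x' \<notin> J"
      using block_J[OF v] by blast+
    then obtain M M' where M: "M \<in> \<pi>" "K \<subseteq> M" "M' \<in> \<pi>" "K' \<subseteq> M'"
      using le_block[OF le R K(1)] le_block[OF le R K(2)] x by blast
    then have "M = L" "M' = L"
      using block_eq[OF v _ L(1)] L x by blast+
    then show ?thesis
      using M by blast
  qed
  moreover have "fst (mk R) \<subseteq> J"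
    using le by (cases "mk R") simp
  ultimately show "dowling_le (mk R') (J, \<pi>)"
  proof (intro mk_leI[OF R' v])
    fix L
    assume "L \<in> R'"
    then have "L = K \<union> K' \<or> L \<in> R"
      by (auto simp: R'_def)
    then show "L \<subseteq> J \<or> (\<exists>M\<in>\<pi>. L \<subseteq> M)"
      using le_block[OF le R, of L] \<open>K \<union> K' \<subseteq> J \<or> _\<close> by blast
  qed (simp add: fst)
qed

lemma block_subset_J:
  assumes u: "(J, \<pi>) \<in> Q" and v: "(J', \<pi>') \<in> Q" and le: "dowling_le (J, \<pi>) (J', \<pi>')"
    and K: "K \<in> \<pi>" "x \<in> K" "x \<in> J'"
  shows "K \<subseteq> J'"
proof -
  have "\<not> K \<subseteq> L" if "L \<in> \<pi>'" for L
    using block_J[OF v that, of x] K by blast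
  then show ?thesis
    using le K(1) unfolding dowling_le_iff by blast
qed

lemma block_subset_block:
  assumes u: "(J, \<pi>) \<in> Q" and v: "(J', \<pi>') \<in> Q" and le: "dowling_le (J, \<pi>) (J', \<pi>')"
    and K: "K \<in> \<pi>" "x \<in> K" and L: "L \<in> \<pi>'" "x \<in> L"
  shows "K \<subseteq> L"
proof -
  have "\<not> K \<subseteq> J'"
    using K L block_J[OF v] by blast
  then obtain L' where "L' \<in> \<pi>'" "K \<subseteq> L'"
    using le K(1) unfolding dowling_le_iff by blast
  then show ?thesis
    using block_eq[OF v _ L(1)] K L by blast
qed

text \<open>Constraints of several kinds amount, above \<open>(J, \<pi>)\<close>, to
  \<open>K\<close> meeting the \<open>J\<close>-part. Stating this equivalence as a hypothesis lets
  them share one construction.\<close>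

lemma closure_J:
  assumes u: "(J, \<pi>) \<in> Q" and K: "K \<in> \<pi>"
    and p: "\<And>w. w \<in> Q \<Longrightarrow> dowling_le (J, \<pi>) w \<Longrightarrow> p \<in> constraints w \<longleftrightarrow> K \<inter> fst w \<noteq> {}"
  obtains v where "v \<in> Q" "dowling_le (J, \<pi>) v" "p \<in> constraints v"
    "card \<pi> = card (snd v) + order G"
    "\<And>w. w \<in> Q \<Longrightarrow> dowling_le (J, \<pi>) w \<Longrightarrow> p \<in> constraints w \<Longrightarrow> dowling_le v w"
proof -
  obtain R where R: "transversal R" "K \<in> R" "(J, \<pi>) = mk R"
    using ex_transversal[OF u transversal_single[OF u K]] K by auto
  let ?v = "mk (R - {K})"
  have "card R = Suc (card (R - {K}))"
    using R transversal_finite by (metis card_Suc_Diff1)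
  moreover have R': "transversal (R - {K})"
    using transversal_subset[OF R(1)] by blast
  ultimately have card: "card \<pi> = card (snd ?v) + order G"
    using card_mk[OF R(1)] card_mk[OF R'] R(3) by (metis mult_Suc_right add.commute snd_conv)
  have v: "?v \<in> Q"
    using mk_in_Q[OF R'] .
  obtain x where x: "x \<in> K"
    using block_nonempty[OF u K] by blast
  have le: "dowling_le (J, \<pi>) ?v"
    using mk_remove_least(1)[OF R(1,2) x] R(3) by simp
  have "x \<in> fst ?v"
    using mk_remove_least(2)[OF R(1,2) x] .
  then have "p \<in> constraints ?v"
    using p[OF v le] x by blast
  moreover have "dowling_le ?v w" if w: "w \<in> Q" "dowling_le (J, \<pi>) w" "p \<in> constraints w" for w
  proof -
    obtain y where "y \<in> K" "y \<in> fst w"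
      using p[OF w(1,2)] w(3) by blast
    then show ?thesis
      using mk_remove_least(3)[OF R(1,2), of y "fst w" "snd w"] w R(3) by simp
  qed
  ultimately show thesis
    using that[OF v le _ card] by blast
qed

lemma closure_merge:
  assumes u: "(J, \<pi>) \<in> Q" and K: "K \<in> \<pi>" "K' \<in> \<pi>" "\<And>g. g \<in> carrier G \<Longrightarrow> K' \<noteq> act g ` K"
    and x: "x \<in> K" "x' \<in> K'"
  obtains v where "v \<in> Q" "dowling_le (J, \<pi>) v" "(x, Some x') \<in> constraints v"
    "card \<pi> = card (snd v) + order G"
    "\<And>w. w \<in> Q \<Longrightarrow> dowling_le (J, \<pi>) w \<Longrightarrow> (x, Some x') \<in> constraints w \<Longrightarrow> dowling_le v w"
proof -
  have pair: "transversal {K, K'}" "K \<noteq> K'"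
    using transversal_pair[OF u K] by blast+
  obtain R where R: "transversal R" "K \<in> R" "K' \<in> R" "(J, \<pi>) = mk R"
    using ex_transversal[OF u pair(1)] K(1,2) by (metis empty_subsetI insert_subset)
  let ?R = "insert (K \<union> K') (R - {K, K'})"
  have R': "transversal ?R"
    using transversal_merge[OF R(1-3)] by simp
  have "card R = Suc (card ?R)"
    using card_transversal_merge(2)[OF R(1-3) pair(2)] .
  then have card: "card \<pi> = card (snd (mk ?R)) + order G"
    using card_mk[OF R(1)] card_mk[OF R'] R(4) by (metis mult_Suc_right add.commute snd_conv)
  have le: "dowling_le (J, \<pi>) (mk ?R)"
    using mk_merge_least(1)[OF R(1-3) x] R(4) by simp
  have "K \<union> K' \<in> snd (mk ?R)"
    using in_snd_mk[OF R'] by simp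
  then have "(x, Some x') \<in> constraints (mk ?R)"
    using x unfolding constraints_def by blast
  moreover have "dowling_le (mk ?R) w"
    if w: "w \<in> Q" "dowling_le (J, \<pi>) w" "(x, Some x') \<in> constraints w" for w
    using mk_merge_least(2)[OF R(1-3) x, of "fst w" "snd w"] w R(4) by simp
  ultimately show thesis
    using that[OF mk_in_Q[OF R'] le _ card] by blast
qed

text \<open>Only points of parts from different orbits cause a merge; every other missing constraint
  forces a whole orbit into the \<open>J\<close>-part. This includes relating a part to a different
  translate of itself: a part containing both would be fixed by the translating element, against
  freeness.\<close>

lemma closure:
  assumes u: "(J, \<pi>) \<in> Q" and p: "p \<in> X \<times> insert None (Some ` X)" "p \<notin> constraints (J, \<pi>)"
  obtains v where "v \<in> Q" "dowling_le (J, \<pi>) v" "p \<in> constraints v"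
    "card \<pi> = card (snd v) + order G"
    "\<And>w. w \<in> Q \<Longrightarrow> dowling_le (J, \<pi>) w \<Longrightarrow> p \<in> constraints w \<Longrightarrow> dowling_le v w"
proof -
  obtain x q where xq: "p = (x, q)" "x \<in> X"
    using p(1) by blast
  have J_iff: "y \<in> fst w \<longleftrightarrow> K \<inter> fst w \<noteq> {}"
    if "K \<in> \<pi>" "y \<in> K" "w \<in> Q" "dowling_le (J, \<pi>) w" for K y w
    using block_subset_J[OF u, of "fst w" "snd w" K] that by auto
  have J_sub: "J \<subseteq> fst w" if "dowling_le (J, \<pi>) w" for w
    using that by (cases w) simp
  show thesis
  proof (cases q)
    case None
    then have "x \<notin> J"
      using p xq by simp
    then obtain K where K: "K \<in> \<pi>" "x \<in> K"
      using ex_block[OF u xq(2)] by blast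
    have "p \<in> constraints w \<longleftrightarrow> K \<inter> fst w \<noteq> {}" if "w \<in> Q" "dowling_le (J, \<pi>) w" for w
      using J_iff[OF K that] xq None by (cases w) simp
    then show thesis
      using closure_J[OF u K(1)] that by blast
  next
    case (Some x')
    then have x': "x' \<in> X"
      using p xq by auto
    have nJ: "\<not> (x \<in> J \<and> x' \<in> J)" and nB: "\<And>K. K \<in> \<pi> \<Longrightarrow> x \<in> K \<Longrightarrow> x' \<notin> K"
      using p(2) xq Some by auto
    have con_iff: "p \<in> constraints w \<longleftrightarrow> x \<in> fst w \<and> x' \<in> fst w \<or> (\<exists>K\<in>snd w. x \<in> K \<and> x' \<in> K)" for w
      using xq Some by (cases w) simp
    have no_block: "y \<notin> L" if "w \<in> Q" "dowling_le (J, \<pi>) w" "y \<in> J" "L \<in> snd w" for w y L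
      using that(1,4) block_J[of "fst w" "snd w" L y] subsetD[OF J_sub[OF that(2)] that(3)] by auto
    consider "x \<in> J" | "x' \<in> J" | "x \<notin> J" "x' \<notin> J"
      by blast
    then show thesis
    proof cases
      case 1
      then obtain K where K: "K \<in> \<pi>" "x' \<in> K"
        using ex_block[OF u x'] nJ by blast
      have "p \<in> constraints w \<longleftrightarrow> K \<inter> fst w \<noteq> {}" if "w \<in> Q" "dowling_le (J, \<pi>) w" for w
        using J_iff[OF K that] 1 J_sub[OF that(2)] no_block[OF that 1] unfolding con_iff by blast
      then show thesis
        using closure_J[OF u K(1)] that by blast
    next
      case 2
      then obtain K where K: "K \<in> \<pi>" "x \<in> K"
        using ex_block[OF u xq(2)] nJ by blast
      have "p \<in> constraints w \<longleftrightarrow> K \<inter> fst w \<noteq> {}" if "w \<in> Q" "dowling_le (J, \<pi>) w" for w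
        using J_iff[OF K that] 2 J_sub[OF that(2)] no_block[OF that 2] unfolding con_iff by blast
      then show thesis
        using closure_J[OF u K(1)] that by blast
    next
      case 3
      obtain K K' where K: "K \<in> \<pi>" "x \<in> K" and K': "K' \<in> \<pi>" "x' \<in> K'"
        using ex_block[OF u xq(2)] ex_block[OF u x'] 3 by blast
      show thesis
      proof (cases "\<exists>g\<in>carrier G. K' = act g ` K")
        case False
        then show thesis
          using closure_merge[OF u K(1) K'(1) _ K(2) K'(2)] that xq Some by blast
      next
        case True
        then obtain g where g: "g \<in> carrier G" "K' = act g ` K"
          by blast
        have "p \<in> constraints w \<longleftrightarrow> K \<inter> fst w \<noteq> {}" if w: "w \<in> Q" "dowling_le (J, \<pi>) w" for w
        proof -
          have w': "(fst w, snd w) \<in> Q" "dowling_le (J, \<pi>) (fst w, snd w)"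
            using w by simp_all
          have "x' \<in> fst w" if xw: "x \<in> fst w"
          proof -
            have "act g x \<in> fst w"
              using act_J[OF w'(1) g(1) xw] .
            moreover have "act g x \<in> K'"
              using g K by simp
            ultimately show ?thesis
              using block_subset_J[OF u w' K'(1)] K'(2) by blast
          qed
          moreover have False if L: "L \<in> snd w" "x \<in> L" "x' \<in> L" for L
          proof -
            have sub: "K \<subseteq> L" "K' \<subseteq> L"
              using block_subset_block[OF u w' K L(1,2)] block_subset_block[OF u w' K' L(1,3)] .
            have "act g x \<in> act g ` L" "act g x \<in> L"
              using g K sub by blast+
            then have "act g ` L = L"
              using block_eq[OF w'(1) act_block[OF w'(1) g(1) L(1)] L(1)] by blast
            then have "g = \<one>"
              using act_block_eq[OF w'(1) g(1) L(1)] by blast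
            then have "K' = K"
              using g act_image_one[OF block_subset[OF u K(1)]] by simp
            then show False
              using nB K K' by blast
          qed
          ultimately show ?thesis
            using J_iff[OF K w] unfolding con_iff by blast
        qed
        then show thesis
          using closure_J[OF u K(1)] that by blast
      qed
    qed
  qed
qed

end

section \<open>Elements with block sizes divisible by \<open>d\<close>\<close>

locale divisible_dowling = dowling G n for G :: "('g, 'b) monoid_scheme" (structure) and n +
  fixes d :: nat
  assumes n_pos: "n \<ge> 1" and d_ge2: "d \<ge> 2"
begin

abbreviation M where "M \<equiv> dowling_mod G n d"
abbreviation zero where "zero \<equiv> dowling_zero G n"

text \<open>The nonzero elements of the poset. Since \<open>T\<close> is upward closed in
  \<open>Q\<close>, closures and joins formed in the Dowling lattice stay inside it.\<close>

definition T where "T = {u \<in> Q. \<forall>K\<in>snd u. d dvd card K}"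

text \<open>On \<open>T\<close> the division is exact, since every orbit of parts has
  \<open>order G\<close> members, and the subtraction is never truncated, since there are at most
  \<open>n div d\<close> orbits.\<close>

definition rk :: "'g dowling \<Rightarrow> nat" where
  "rk u = (if u = zero then 0 else n div d + 1 - card (snd u) div order G)"

lemma T_subset_Q: "u \<in> T \<Longrightarrow> u \<in> Q"
  by (simp add: T_def)

lemma order_pos: "order G > 0"
  using finite_carrier by (simp add: order_gt_0_iff_finite)

lemma zero_eq_mk: "zero = mk ((\<lambda>m. {(\<one>, m)}) ` {1..n})"
  and transversal_zero: "transversal ((\<lambda>m. {(\<one>, m)}) ` {1..n})"
proof -
  let ?R = "(\<lambda>m. {(\<one>, m)}) ` {1..n}"
  have U: "\<Union>?R = {\<one>} \<times> {1..n}"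
    by auto
  have "fst (mk ?R) = {}"
    unfolding mk_def U by (auto simp: dowling_ground_def)
  moreover have "snd (mk ?R) = snd zero"
  proof
    show "snd (mk ?R) \<subseteq> snd zero"
      by (auto simp: mk_def dowling_zero_def)
    show "snd zero \<subseteq> snd (mk ?R)"
    proof
      fix L
      assume "L \<in> snd zero"
      then obtain g m where L: "L = {(g, m)}" "g \<in> carrier G" "m \<in> {1..n}"
        by (auto simp: dowling_zero_def)
      then have "L = act g ` {(\<one>, m)}"
        by simp
      then show "L \<in> snd (mk ?R)"
        using L(2,3) unfolding mk_def by force
    qed
  qed
  ultimately show "zero = mk ?R"
    by (simp add: dowling_zero_def prod_eq_iff)
  show "transversal ?R"
    unfolding transversal_def U by (auto simp: disjoint_def dowling_ground_def inj_on_def)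
qed

lemma zero_in_Q: "zero \<in> Q"
  using mk_in_Q[OF transversal_zero] zero_eq_mk by simp

lemma zero_not_in_T: "zero \<notin> T"
proof -
  have "{(\<one>, 1)} \<in> snd zero"
    using n_pos by (auto simp: dowling_zero_def)
  moreover have "\<not> d dvd card {(\<one>, 1)}"
    using d_ge2 by simp
  ultimately show ?thesis
    unfolding T_def by blast
qed

lemma carrier_M: "carrier M = insert zero T"
  using zero_in_Q by (auto simp: dowling_mod_def dowling_lattice_def T_def)

lemma le_M [simp]: "le M = dowling_le" and eq_M [simp]: "eq M = (=)"
  by (simp_all add: dowling_mod_def dowling_lattice_def)

lemma carrier_M_subset: "u \<in> carrier M \<Longrightarrow> u \<in> Q"
  using carrier_M T_subset_Q zero_in_Q by (metis insertE)

lemma zero_le: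
  assumes "u \<in> Q"
  shows "dowling_le zero u"
proof (cases u)
  case (Pair J \<pi>)
  have "L \<subseteq> J \<or> (\<exists>K\<in>\<pi>. L \<subseteq> K)" if L: "L \<in> {{(g, m)} |g m. g \<in> carrier G \<and> m \<in> {1..n}}" for L
  proof -
    obtain g m where "L = {(g, m)}" "g \<in> carrier G" "m \<in> {1..n}"
      using L by blast
    then show ?thesis
      using ex_block[of J \<pi> "(g, m)"] assms Pair by (auto simp: dowling_ground_def)
  qed
  then show ?thesis
    unfolding dowling_zero_def Pair dowling_le_iff by blast
qed

lemma transversal_empty: "transversal {}"
  by (simp add: transversal_def)

lemma top_in_T: "mk {} \<in> T"
  unfolding T_def using mk_in_Q[OF transversal_empty] by (simp add: mk_def)

lemma le_top:
  assumes "u \<in> Q"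
  shows "dowling_le u (mk {})"
  using J_subset[of "fst u" "snd u"] block_subset[of "fst u" "snd u"] assms
  by (cases u) (simp add: mk_def)

text \<open>A part of the larger element avoids the smaller \<open>J\<close>-part, so it is a
  disjoint union of smaller parts and its size is a sum of multiples of \<open>d\<close>.\<close>

lemma T_upward:
  assumes u: "u \<in> T" and v: "v \<in> Q" and le: "dowling_le u v"
  shows "v \<in> T"
proof -
  obtain J \<pi> J' \<pi>' where uv: "u = (J, \<pi>)" "v = (J', \<pi>')"
    by (cases u; cases v)
  have Q: "(J, \<pi>) \<in> Q" "(J', \<pi>') \<in> Q" and le': "dowling_le (J, \<pi>) (J', \<pi>')"
    using u v le uv T_subset_Q by auto
  have "d dvd card L" if L: "L \<in> \<pi>'" for L
  proof -
    let ?S = "{K \<in> \<pi>. K \<subseteq> L}"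
    have "L \<subseteq> \<Union>?S"
    proof
      fix x
      assume x: "x \<in> L"
      then have "x \<notin> J"
        using block_J[OF Q(2) L x] le' by auto
      then obtain K where K: "K \<in> \<pi>" "x \<in> K"
        using ex_block[OF Q(1)] block_subset[OF Q(2) L] x by blast
      then show "x \<in> \<Union>?S"
        using block_subset_block[OF Q le' K L x] by blast
    qed
    then have "L = \<Union>?S"
      by blast
    moreover have "card (\<Union>?S) = sum card ?S"
    proof (rule card_Union_disjoint)
      show "pairwise disjnt ?S"
        using block_eq[OF Q(1)] unfolding pairwise_def disjnt_def by blast
      show "finite K" if "K \<in> ?S" for K
        using that block_subset[OF Q(1), of K] finite_X finite_subset by blast
    qed
    moreover have "d dvd sum card ?S"
      using u by (intro dvd_sum) (auto simp: T_def uv)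
    ultimately show ?thesis
      by simp
  qed
  then show ?thesis
    using v by (simp add: T_def uv)
qed

lemma card_act_image: "g \<in> carrier G \<Longrightarrow> K \<subseteq> X \<Longrightarrow> card (act g ` K) = card K"
proof (rule card_image, rule inj_onI)
  fix x y
  assume *: "g \<in> carrier G" "K \<subseteq> X" "x \<in> K" "y \<in> K" "act g x = act g y"
  then have "act (inv g) (act g x) = act (inv g) (act g y)"
    by simp
  then show "x = y"
    using * act_act[of "inv g" g] act_one by (metis inv_closed l_inv subsetD)
qed

lemma mk_in_T:
  assumes "transversal R"
  shows "mk R \<in> T \<longleftrightarrow> (\<forall>K\<in>R. d dvd card K)"
proof -
  have sub: "K \<subseteq> X" if "K \<in> R" for K
    using assms that by (auto simp: transversal_def)
  have "d dvd card L" if R: "\<forall>K\<in>R. d dvd card K" and L: "L \<in> snd (mk R)" for L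
  proof -
    obtain g K where "L = act g ` K" "g \<in> carrier G" "K \<in> R"
      using L by (auto simp: mk_def)
    then show ?thesis
      using R card_act_image sub by simp
  qed
  then have "(\<forall>K\<in>snd (mk R). d dvd card K) \<longleftrightarrow> (\<forall>K\<in>R. d dvd card K)"
    using in_snd_mk[OF assms] by blast
  then show ?thesis
    unfolding T_def using mk_in_Q[OF assms] by simp
qed

lemma T_eq_mk:
  assumes "u \<in> T"
  obtains R where "transversal R" "u = mk R" "\<And>K. K \<in> R \<Longrightarrow> d dvd card K"
proof -
  obtain R where "transversal R" "u = mk R"
    using ex_transversal[of "fst u" "snd u", OF _ transversal_empty] assms T_subset_Q
    by (metis empty_subsetI prod.collapse)
  then show thesis
    using that mk_in_T assms by blast
qed

lemma transversal_card_sum: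
  assumes R: "transversal R"
  shows "(\<Sum>K\<in>R. card K) + card ({1..n} - snd ` \<Union>R) = n"
proof -
  have "finite (\<Union>R)"
    using R finite_X finite_subset by (auto simp: transversal_def)
  then have "(\<Sum>K\<in>R. card K) = card (\<Union>R)"
    using R by (subst card_Union_disjoint)
      (auto simp: transversal_def disjoint_def pairwise_def disjnt_def intro: finite_subset)
  also have "\<dots> = card (snd ` \<Union>R)"
    using R by (simp add: transversal_def card_image)
  moreover have sub: "snd ` \<Union>R \<subseteq> {1..n}"
    using R by (fastforce simp: transversal_def dowling_ground_def)
  moreover have "card ({1..n} - snd ` \<Union>R) = card {1..n} - card (snd ` \<Union>R)"
    using sub by (intro card_Diff_subset) (auto intro: finite_subset)
  moreover have "card (snd ` \<Union>R) \<le> card {1..n}"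
    using sub by (intro card_mono) auto
  ultimately show ?thesis
    by simp
qed

lemma card_ge_d:
  assumes "transversal R" "K \<in> R" "d dvd card K"
  shows "d \<le> card K"
proof -
  have "K \<subseteq> X" "K \<noteq> {}"
    using assms by (auto simp: transversal_def)
  then have "finite K" "K \<noteq> {}"
    using finite_subset finite_X by auto
  then show ?thesis
    using assms(3) by (intro dvd_imp_le) (auto simp: card_gt_0_iff)
qed

text \<open>Representatives occupy pairwise disjoint sets of at least \<open>d\<close> of the
  \<open>n\<close> columns.\<close>

lemma card_transversal_le:
  assumes R: "transversal R" and "\<And>K. K \<in> R \<Longrightarrow> d dvd card K"
  shows "card R \<le> n div d"
proof -
  have "d * card R = (\<Sum>K\<in>R. d)"
    by simp
  also have "\<dots> \<le> (\<Sum>K\<in>R. card K)"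
    using card_ge_d[OF R _ assms(2)] by (intro sum_mono)
  also have "\<dots> \<le> n"
    using transversal_card_sum[OF R] by simp
  finally show ?thesis
    using d_ge2 by (simp add: less_eq_div_iff_mult_less_eq mult.commute)
qed

lemma mk_le_mkI:
  assumes R: "transversal R" "transversal R'" and "snd ` \<Union>R \<subseteq> snd ` \<Union>R'"
    and "\<And>K'. K' \<in> R' \<Longrightarrow> K' \<subseteq> fst (mk R) \<or> (\<exists>K\<in>R. K' \<subseteq> K)"
  shows "dowling_le (mk R') (mk R)"
proof -
  have "dowling_le (mk R') (fst (mk R), snd (mk R))"
  proof (rule mk_leI[OF R(2)])
    show "(fst (mk R), snd (mk R)) \<in> Q"
      using mk_in_Q[OF R(1)] by simp
    show "fst (mk R') \<subseteq> fst (mk R)"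
      using assms(3) by (auto simp: mk_def)
    show "K' \<subseteq> fst (mk R) \<or> (\<exists>L\<in>snd (mk R). K' \<subseteq> L)" if "K' \<in> R'" for K'
      using assms(4)[OF that] in_snd_mk[OF R(1)] by blast
  qed
  then show ?thesis
    by simp
qed

lemma transversal_insert:
  assumes R: "transversal R" and K: "K \<subseteq> X" "K \<noteq> {}" "inj_on snd K" "snd ` K \<inter> snd ` \<Union>R = {}"
  shows "transversal (insert K R)" "K \<notin> R"
proof -
  have "K \<inter> \<Union>R = {}"
    using K(4) by blast
  then show "K \<notin> R"
    using K(2) by blast
  have "disjoint (insert K R)"
    using R \<open>K \<inter> \<Union>R = {}\<close> unfolding transversal_def disjoint_def by blast
  moreover have "inj_on snd (K \<union> \<Union>R)"
    using R K(3,4) \<open>K \<inter> \<Union>R = {}\<close> unfolding transversal_def inj_on_Un by blast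
  ultimately show "transversal (insert K R)"
    using R K unfolding transversal_def by simp
qed

lemma transversal_split:
  assumes R: "transversal R" and K: "K \<in> R" "A \<union> B = K" "A \<inter> B = {}" "A \<noteq> {}" "B \<noteq> {}"
  shows "transversal (insert A (insert B (R - {K})))" "card (insert A (insert B (R - {K}))) = Suc (card R)"
    "dowling_le (mk (insert A (insert B (R - {K})))) (mk R)"
proof -
  let ?R = "insert A (insert B (R - {K}))"
  have U: "\<Union>?R = \<Union>R"
    using K(1,2) by blast
  have dis: "K \<inter> L = {}" if "L \<in> R - {K}" for L
    using R K(1) that unfolding transversal_def disjoint_def by blast
  then have "disjoint ?R"
    using R K(2,3) unfolding transversal_def disjoint_def by blast
  then show R': "transversal ?R"
    using R K(4,5) unfolding transversal_def U by simp
  have "A \<notin> R - {K}" "B \<notin> R - {K}"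
    using dis K by blast+
  moreover have "A \<noteq> B"
    using K by blast
  ultimately show "card ?R = Suc (card R)"
    using transversal_finite[OF R] K(1) card.remove[of R K] by simp
  have "L \<subseteq> fst (mk R) \<or> (\<exists>K\<in>R. L \<subseteq> K)" if "L \<in> ?R" for L
    using that K(1,2) by blast
  then show "dowling_le (mk ?R) (mk R)"
    using mk_le_mkI[OF R R'] U by simp
qed

text \<open>This forces covers of \<open>zero\<close> to have rank 1: with fewer than
  \<open>n div d\<close> representatives an element of \<open>T\<close> is not minimal. Either some
  block is larger than \<open>d\<close> and splits, or all blocks have size \<open>d\<close> and
  enough columns of the \<open>J\<close>-part remain to form another one.\<close>

lemma ex_finer:
  assumes R: "transversal R" and d: "\<And>K. K \<in> R \<Longrightarrow> d dvd card K" and less: "card R < n div d"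
  obtains R' where "transversal R'" "\<And>K. K \<in> R' \<Longrightarrow> d dvd card K" "card R' = Suc (card R)"
    "dowling_le (mk R') (mk R)"
proof (cases "\<exists>K\<in>R. card K \<noteq> d")
  case True
  then obtain K where K: "K \<in> R" "card K \<noteq> d"
    by blast
  then have "d < card K"
    using card_ge_d[OF R K(1)] d by force
  then obtain A where A: "A \<subseteq> K" "card A = d"
    using obtain_subset_with_card_n[of d K] by auto
  have "finite K"
    using \<open>d < card K\<close> card.infinite by force
  then have "card (K - A) = card K - d"
    using A by (simp add: card_Diff_subset finite_subset)
  then have "card (K - A) \<noteq> 0" "d dvd card (K - A)"
    using \<open>d < card K\<close> d[OF K(1)] by (auto intro!: dvd_diff_nat)
  then have "K - A \<noteq> {}" "d dvd card (K - A)"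
    by force+
  moreover have "A \<noteq> {}"
    using A d_ge2 by auto
  moreover have "A \<union> (K - A) = K" "A \<inter> (K - A) = {}"
    using A by blast+
  moreover have "d dvd card L" if "L \<in> insert A (insert (K - A) (R - {K}))" for L
    using that A(2) d \<open>d dvd card (K - A)\<close> by auto
  ultimately show thesis
    using that[of "insert A (insert (K - A) (R - {K}))"] transversal_split[OF R K(1), of A "K - A"]
    by blast
next
  case False
  let ?C = "{1..n} - snd ` \<Union>R"
  have "(\<Sum>K\<in>R. card K) = d * card R"
    using False by simp
  then have "card ?C = n - d * card R"
    using transversal_card_sum[OF R] by simp
  moreover have "d * Suc (card R) \<le> n"
    using less d_ge2 by (metis Suc_leI div_times_less_eq_dividend dual_order.trans mult.commute mult_le_mono2)
  ultimately have "d \<le> card ?C"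
    by simp
  then obtain B where B: "B \<subseteq> ?C" "card B = d"
    using obtain_subset_with_card_n by metis
  \<comment> \<open>The label \<open>\<one>\<close> is an arbitrary choice, as every point over
    these columns lies in the \<open>J\<close>-part.\<close>
  let ?K = "{\<one>} \<times> B"
  have K: "?K \<subseteq> X" "inj_on snd ?K" "card ?K = d" "snd ` ?K = B"
    using B by (auto simp: dowling_ground_def inj_on_def card_cartesian_product)
  then have "?K \<noteq> {}"
    using d_ge2 by auto
  then have R': "transversal (insert ?K R)" "?K \<notin> R"
    using transversal_insert[OF R K(1) _ K(2)] B(1) unfolding K(4) by blast+
  moreover have "?K \<subseteq> fst (mk R)"
    using K(1) B(1) unfolding mk_def by force
  then have "dowling_le (mk (insert ?K R)) (mk R)"
    using mk_le_mkI[OF R R'(1)] by auto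
  moreover have "d dvd card L" if "L \<in> insert ?K R" for L
    using that d K(3) by auto
  moreover have "card (insert ?K R) = Suc (card R)"
    using R'(2) transversal_finite[OF R] by simp
  ultimately show thesis
    using that[of "insert ?K R"] by blast
qed

lemma card_div_order: "transversal R \<Longrightarrow> card (snd (mk R)) div order G = card R"
  using order_pos by (simp add: card_mk)

lemma rk_mk:
  assumes "transversal R" "mk R \<in> T"
  shows "rk (mk R) = n div d + 1 - card R"
  using assms zero_not_in_T by (auto simp: rk_def card_div_order)

section \<open>Closure and covering relation in the divisible sub-poset\<close>

lemma lless_M: "u \<sqsubset>\<^bsub>M\<^esub> v \<longleftrightarrow> dowling_le u v \<and> u \<noteq> v"
  by (simp add: lless_def)

lemma partial_order_M: "partial_order M"
proof
  show "x \<sqsubseteq>\<^bsub>M\<^esub> z" if "x \<sqsubseteq>\<^bsub>M\<^esub> y" "y \<sqsubseteq>\<^bsub>M\<^esub> z" "x \<in> carrier M" "y \<in> carrier M" "z \<in> carrier M" for x y z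
    using that le_trans carrier_M_subset by (simp del: dowling_le_iff) blast
  show "x .=\<^bsub>M\<^esub> y" if "x \<sqsubseteq>\<^bsub>M\<^esub> y" "y \<sqsubseteq>\<^bsub>M\<^esub> x" "x \<in> carrier M" "y \<in> carrier M" for x y
    using that le_antisym carrier_M_subset by (simp del: dowling_le_iff)
qed (auto simp: le_refl simp del: dowling_le_iff)

lemma constraints_subset:
  assumes "u \<in> Q"
  shows "constraints u \<subseteq> X \<times> insert None (Some ` X)"
proof -
  have "(fst u, snd u) \<in> Q"
    using assms by simp
  then show ?thesis
    using J_subset[of "fst u" "snd u"] block_subset[of "fst u" "snd u"] unfolding constraints_def by blast
qed

lemma le_iff: "u \<in> Q \<Longrightarrow> v \<in> Q \<Longrightarrow> dowling_le u v \<longleftrightarrow> constraints u \<subseteq> constraints v"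
  using le_iff_constraints by (cases u; cases v) simp

text \<open>The rank rises by exactly one because exactly one orbit of parts disappears.\<close>

lemma closure_T:
  assumes u: "u \<in> T" and p: "p \<in> X \<times> insert None (Some ` X)" "p \<notin> constraints u"
  obtains v where "v \<in> T" "dowling_le u v" "p \<in> constraints v" "rk v = Suc (rk u)"
    "\<And>w. w \<in> Q \<Longrightarrow> dowling_le u w \<Longrightarrow> p \<in> constraints w \<Longrightarrow> dowling_le v w"
proof -
  obtain R where R: "transversal R" "u = mk R" "\<And>K. K \<in> R \<Longrightarrow> d dvd card K"
    using T_eq_mk[OF u] by blast
  obtain J \<pi> where Jp: "u = (J, \<pi>)"
    by fastforce
  obtain v where v: "v \<in> Q" "dowling_le u v" "p \<in> constraints v"
    and card: "card (snd u) = card (snd v) + order G"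
    and least: "\<And>w. w \<in> Q \<Longrightarrow> dowling_le u w \<Longrightarrow> p \<in> constraints w \<Longrightarrow> dowling_le v w"
    using closure[of J \<pi> p] p T_subset_Q[OF u] Jp by (metis snd_conv)
  have vT: "v \<in> T"
    using T_upward[OF u v(1,2)] .
  have "card (snd u) div order G = Suc (card (snd v) div order G)"
    using card order_pos by simp
  moreover have "card (snd u) div order G \<le> n div d"
    using card_div_order[OF R(1)] card_transversal_le[OF R(1,3)] R(2) by simp
  ultimately have "rk v = Suc (rk u)"
    unfolding rk_def using u vT zero_not_in_T by auto
  then show thesis
    using that[OF vT v(2,3) _ least] by blast
qed

lemma ex_constraint:
  assumes "u \<in> Q" "v \<in> Q" "dowling_le u v" "u \<noteq> v"
  obtains p where "p \<in> X \<times> insert None (Some ` X)" "p \<notin> constraints u" "p \<in> constraints v"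
proof -
  have "\<not> dowling_le v u"
    using assms le_antisym by blast
  then show thesis
    using that le_iff assms constraints_subset[OF assms(2)] by blast
qed

lemma covers_zero:
  assumes "covers M u zero"
  shows "u \<in> T" "rk u = 1"
proof -
  show u: "u \<in> T"
    using assms by (auto simp: covers_def lless_M carrier_M)
  obtain R where R: "transversal R" "u = mk R" "\<And>K. K \<in> R \<Longrightarrow> d dvd card K"
    using T_eq_mk[OF u] by blast
  have "card R \<le> n div d"
    using card_transversal_le[OF R(1,3)] .
  moreover have "\<not> card R < n div d"
  proof
    assume "card R < n div d"
    then obtain R' where R': "transversal R'" "\<And>K. K \<in> R' \<Longrightarrow> d dvd card K" "card R' = Suc (card R)"
      "dowling_le (mk R') (mk R)"
      using ex_finer[OF R(1,3)] by blast
    have T': "mk R' \<in> T"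
      using mk_in_T[OF R'(1)] R'(2) by blast
    moreover have "zero \<sqsubset>\<^bsub>M\<^esub> mk R'"
      unfolding lless_M using zero_le[OF T_subset_Q[OF T']] T' zero_not_in_T by auto
    moreover have "mk R' \<noteq> mk R"
      using card_div_order[OF R(1)] card_div_order[OF R'(1)] R'(3) by auto
    then have "mk R' \<sqsubset>\<^bsub>M\<^esub> u"
      unfolding lless_M using R' R(2) by simp
    ultimately show False
      using assms carrier_M unfolding covers_def by blast
  qed
  ultimately show "rk u = 1"
    using rk_mk[OF R(1)] u R(2) by simp
qed

text \<open>The closure of \<open>p\<close> over \<open>u\<close> lies strictly above
  \<open>u\<close> and below \<open>v\<close>, so it is \<open>v\<close>: a cover is generated by
  any single constraint that it adds.\<close>

lemma covers_closure:
  assumes u: "u \<in> T" and v: "covers M v u"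
    and p: "p \<in> X \<times> insert None (Some ` X)" "p \<notin> constraints u" "p \<in> constraints v"
  shows "v \<in> T" "rk v = Suc (rk u)"
    "w \<in> Q \<Longrightarrow> dowling_le u w \<Longrightarrow> p \<in> constraints w \<Longrightarrow> dowling_le v w"
proof -
  obtain v' where v': "v' \<in> T" "dowling_le u v'" "p \<in> constraints v'" "rk v' = Suc (rk u)"
    and least: "\<And>w. w \<in> Q \<Longrightarrow> dowling_le u w \<Longrightarrow> p \<in> constraints w \<Longrightarrow> dowling_le v' w"
    using closure_T[OF u p(1,2)] by blast
  have vu: "v \<in> Q" "dowling_le u v"
    using v carrier_M_subset by (auto simp: covers_def lless_M)
  have "dowling_le v' v"
    using least[OF vu p(3)] .
  moreover have "u \<sqsubset>\<^bsub>M\<^esub> v'"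
    using v' p(2) by (auto simp: lless_M)
  ultimately have "v' = v"
    using v v'(1) unfolding covers_def lless_M carrier_M by blast
  then show "v \<in> T" "rk v = Suc (rk u)"
    "w \<in> Q \<Longrightarrow> dowling_le u w \<Longrightarrow> p \<in> constraints w \<Longrightarrow> dowling_le v w"
    using v' least by blast+
qed

lemma covers_rk:
  assumes "covers M v u"
  shows "rk v = Suc (rk u)"
proof (cases "u = zero")
  case True
  then show ?thesis
    using covers_zero assms by (simp add: rk_def)
next
  case False
  then have u: "u \<in> T" "u \<in> Q" "v \<in> Q" "dowling_le u v" "u \<noteq> v"
    using assms carrier_M T_subset_Q carrier_M_subset by (auto simp: covers_def lless_M)
  then show ?thesis
    using ex_constraint[OF u(2-5)] covers_closure(2)[OF u(1) assms] by blast
qed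

lemma zero_in_M: "zero \<in> carrier M" and T_subset_M: "u \<in> T \<Longrightarrow> u \<in> carrier M"
  by (simp_all add: carrier_M)

end

sublocale divisible_dowling \<subseteq> M: graded_poset M rk zero "mk {}"
proof (intro graded_poset.intro graded_poset_axioms.intro)
  show "partial_order M"
    using partial_order_M .
  show "finite (carrier M)"
    using finite_Q carrier_M_subset by (meson finite_subset subsetI)
  show "least M zero (carrier M)"
    using zero_in_M zero_le carrier_M_subset by (simp add: least_def)
  show "greatest M (mk {}) (carrier M)"
    using T_subset_M[OF top_in_T] le_top carrier_M_subset by (simp add: greatest_def)
  show "rk v = Suc (rk u)" if "covers M v u" for u v
    using covers_rk that .
qed

section \<open>Semimodularity, joins and the rank formula\<close>

context divisible_dowling
begin

lemma rk_top: "rk (mk {}) = n div d + 1"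
  using rk_mk[OF transversal_empty top_in_T] by simp

lemma rk_zero: "rk zero = 0"
  by (simp add: rk_def)

lemma covers_M_iff:
  assumes "u \<in> carrier M" "v \<in> carrier M"
  shows "covers M v u \<longleftrightarrow> dowling_le u v \<and> rk v = Suc (rk u)"
proof -
  have "dowling_le u v \<and> rk v = Suc (rk u) \<Longrightarrow> u \<sqsubset>\<^bsub>M\<^esub> v"
    by (auto simp: lless_M)
  then show ?thesis
    using M.covers_iff_rank[OF assms] covers_rk[of v u] by (auto simp: covers_def lless_M)
qed

text \<open>Take one constraint that generates \<open>w\<close> over \<open>u\<close> and impose it
  on \<open>v\<close>. The result \<open>t\<close> is a cover of \<open>v\<close> by rank, lies
  above \<open>w\<close> because \<open>w\<close> is least over \<open>u\<close> with this
  constraint, and lies below \<open>y\<close> because \<open>y\<close> satisfies it.\<close>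

lemma semimodular_above:
  assumes u: "u \<in> T" and vw: "covers M v u" "covers M w u" "v \<noteq> w"
    and y: "y \<in> carrier M" "dowling_le v y" "dowling_le w y"
  obtains t where "covers M t v" "dowling_le t y" "w \<sqsubset>\<^bsub>M\<^esub> t"
proof -
  have Q: "u \<in> Q" "v \<in> Q" "w \<in> Q" "y \<in> Q" and le: "dowling_le u v" "dowling_le u w" "u \<noteq> v" "u \<noteq> w"
    using u vw y(1) carrier_M_subset T_subset_Q by (auto simp: covers_def lless_M)
  obtain p where p: "p \<in> X \<times> insert None (Some ` X)" "p \<notin> constraints u" "p \<in> constraints w"
    using ex_constraint[OF Q(1,3) le(2,4)] .
  note w = covers_closure[OF u vw(2) p]
  have v: "v \<in> T" "rk v = Suc (rk u)"
    using T_upward[OF u Q(2) le(1)] covers_rk[OF vw(1)] by simp_all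
  have pv: "p \<notin> constraints v"
  proof
    assume "p \<in> constraints v"
    then have "dowling_le w v"
      using w(3)[OF Q(2) le(1)] by blast
    then have "w \<sqsubset>\<^bsub>M\<^esub> v"
      using vw(3) by (simp add: lless_M)
    then show False
      using vw(1,2) by (auto simp: covers_def)
  qed
  obtain t where t: "t \<in> T" "dowling_le v t" "p \<in> constraints t" "rk t = Suc (rk v)"
    and least: "\<And>w. w \<in> Q \<Longrightarrow> dowling_le v w \<Longrightarrow> p \<in> constraints w \<Longrightarrow> dowling_le t w"
    using closure_T[OF v(1) p(1) pv] by blast
  have "covers M t v"
    using covers_M_iff t v(1) T_subset_M by simp
  moreover have "dowling_le t y"
    using least[OF Q(4) y(2)] p(3) y(3) le_iff[OF Q(3,4)] by blast
  moreover have "dowling_le u t"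
    using le_trans[OF Q(1,2) _ le(1) t(2)] t(1) T_subset_Q by blast
  then have "dowling_le w t"
    using w(3) t(1,3) T_subset_Q by blast
  then have "w \<sqsubset>\<^bsub>M\<^esub> t"
    using w(2) t(4) v(2) by (auto simp: lless_M)
  ultimately show thesis
    using that by blast
qed

lemma upper_semimodular_above:
  assumes a: "a \<in> T"
  shows "upper_semimodular (interval_poset M a (mk {}))"
  unfolding upper_semimodular_def
proof (intro allI impI)
  let ?I = "interval_poset M a (mk {})"
  fix u v w y
  assume vw: "covers ?I v u" "covers ?I w u" "v \<noteq> w"
    and y: "y \<in> carrier ?I" "v \<sqsubseteq>\<^bsub>?I\<^esub> y" "w \<sqsubseteq>\<^bsub>?I\<^esub> y"
  note c = M.covers_interval[OF T_subset_M[OF a] T_subset_M[OF top_in_T]]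
  have y': "y \<in> carrier M" "dowling_le v y" "dowling_le w y"
    using y by (auto simp: interval_poset_def at_least_at_most_def)
  have *: "u \<in> carrier M" "dowling_le a u" "covers M v u" "covers M w u" "dowling_le a v" "v \<in> carrier M"
    using vw unfolding c by auto
  then have u: "u \<in> T"
    using T_upward[OF a] carrier_M_subset by blast
  obtain t where t: "covers M t v" "dowling_le t y" "w \<sqsubset>\<^bsub>M\<^esub> t"
    using semimodular_above[OF u *(3,4) vw(3) y'] .
  then have "t \<in> carrier M" "dowling_le v t"
    by (auto simp: covers_def lless_M)
  moreover from this have "dowling_le a t" "dowling_le t (mk {})"
    using le_trans[of a v t] le_top a * T_subset_Q carrier_M_subset by blast+
  moreover have "dowling_le v (mk {})"
    using le_top * carrier_M_subset by blast
  ultimately have "covers ?I t v"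
    using t(1) * unfolding c by simp
  then show "\<exists>t. covers ?I t v \<and> t \<sqsubseteq>\<^bsub>?I\<^esub> y \<and> w \<sqsubset>\<^bsub>?I\<^esub> t"
    using t by (intro exI[of _ t]) (simp add: interval_poset_def lless_def)
qed

text \<open>The finitely many constraints of \<open>v\<close> are imposed on \<open>u\<close> one
  after another, each in the least way.\<close>

lemma ex_join_T:
  assumes u: "u \<in> T" and v: "v \<in> Q"
  obtains s where "s \<in> T" "dowling_le u s" "dowling_le v s"
    "\<And>w. w \<in> Q \<Longrightarrow> dowling_le u w \<Longrightarrow> dowling_le v w \<Longrightarrow> dowling_le s w"
proof -
  have "finite (X \<times> insert None (Some ` X))"
    using finite_X by simp
  then have "finite (constraints v)"
    using constraints_subset[OF v] finite_subset by blast
  then have "\<exists>s\<in>T. dowling_le u s \<and> constraints v \<subseteq> constraints s \<and>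
      (\<forall>w\<in>Q. dowling_le u w \<longrightarrow> constraints v \<subseteq> constraints w \<longrightarrow> dowling_le s w)"
    using constraints_subset[OF v]
  proof (induction rule: finite_subset_induct')
    case empty
    then show ?case
      using u le_refl by blast
  next
    case (insert p F)
    then obtain s where s: "s \<in> T" "dowling_le u s" "F \<subseteq> constraints s"
      "\<And>w. w \<in> Q \<Longrightarrow> dowling_le u w \<Longrightarrow> F \<subseteq> constraints w \<Longrightarrow> dowling_le s w"
      by blast
    show ?case
    proof (cases "p \<in> constraints s")
      case True
      then show ?thesis
        using s by blast
    next
      case False
      obtain t where t: "t \<in> T" "dowling_le s t" "p \<in> constraints t"
        and least: "\<And>w. w \<in> Q \<Longrightarrow> dowling_le s w \<Longrightarrow> p \<in> constraints w \<Longrightarrow> dowling_le t w"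
        using closure_T[OF s(1) insert(2) False] by blast
      have "dowling_le u t"
        using le_trans[OF _ _ _ s(2) t(2)] u s(1) t(1) T_subset_Q by blast
      moreover have "F \<subseteq> constraints t"
        using s(1,3) t(1,2) le_iff T_subset_Q by blast
      ultimately show ?thesis
        using t s(4) least by blast
    qed
  qed
  then show thesis
    using that le_iff[OF v] T_subset_Q by blast
qed

lemma upper_semilattice_M: "upper_semilattice M"
proof (intro upper_semilattice.intro upper_semilattice_axioms.intro partial_order_M)
  fix u v
  assume uv: "u \<in> carrier M" "v \<in> carrier M"
  have *: "\<exists>s\<in>carrier M. dowling_le u s \<and> dowling_le v s \<and>
      (\<forall>w\<in>carrier M. dowling_le u w \<longrightarrow> dowling_le v w \<longrightarrow> dowling_le s w)"
  proof (cases "u = zero")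
    case True
    then show ?thesis
      using uv zero_le le_refl carrier_M_subset by blast
  next
    case False
    then have "u \<in> T"
      using uv carrier_M by blast
    then show ?thesis
      using ex_join_T[of u v] uv carrier_M_subset T_subset_M by metis
  qed
  then show "\<exists>s. least M s (Upper M {u, v})"
    using uv unfolding least_def Upper_def le_M by blast
qed

lemma rank_formula:
  assumes u: "(J, \<pi>) \<in> carrier M"
  shows "real (poset_rank M (J, \<pi>)) =
    (if (J, \<pi>) = zero then 0 else real (n div d) + 1 - real (card \<pi>) / real (order G))"
proof -
  let ?u = "(J, \<pi>)"
  interpret I: graded_poset "interval_poset M zero ?u" rk zero ?u
    using M.graded_interval[OF zero_in_M u] zero_le[OF carrier_M_subset[OF u]] by simp
  have rank: "poset_rank M ?u = rk ?u"
    unfolding poset_rank_def M.bottom_eq_b using I.length_eq rk_zero by simp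
  show ?thesis
  proof (cases "?u = zero")
    case True
    then show ?thesis
      unfolding rank by (simp add: rk_def)
  next
    case False
    then have "?u \<in> T"
      using u carrier_M by auto
    then obtain R where R: "transversal R" "?u = mk R" "\<And>K. K \<in> R \<Longrightarrow> d dvd card K"
      using T_eq_mk by blast
    have "card \<pi> = order G * card R"
      using card_mk[OF R(1)] R(2) by (metis snd_conv)
    then have "real (card \<pi>) / real (order G) = real (card R)"
      using order_pos by simp
    moreover have "rk ?u = n div d + 1 - card R"
      using rk_mk[OF R(1)] \<open>?u \<in> T\<close> R(2) by simp
    ultimately show ?thesis
      unfolding rank using False card_transversal_le[OF R(1,3)] by (simp add: of_nat_diff)
  qed
qed

end

section \<open>The ordering of the atoms\<close>

text \<open>Uniqueness of the best atom rests on this: the right-hand side depends on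
  \<open>U\<close> and \<open>d\<close> only. To the left of an element of a block lie only whole
  blocks and elements of the same block, so its position divided by \<open>d\<close> is the number
  of blocks to the left.\<close>

lemma separated_blocks:
  fixes U :: "nat set" and P :: "nat set set"
  assumes U: "finite U" and d: "d > 0"
    and P: "\<And>B. B \<in> P \<Longrightarrow> B \<subseteq> U \<and> card B = d"
    and sep: "\<And>B B'. B \<in> P \<Longrightarrow> B' \<in> P \<Longrightarrow> B \<noteq> B' \<Longrightarrow>
      (\<forall>x\<in>B. \<forall>y\<in>B'. x < y) \<or> (\<forall>x\<in>B. \<forall>y\<in>B'. y < x)"
    and rest: "\<And>B x y. B \<in> P \<Longrightarrow> x \<in> B \<Longrightarrow> y \<in> U - \<Union>P \<Longrightarrow> x < y" "card (U - \<Union>P) < d"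
  shows "P = (\<lambda>j. {x \<in> U. card {y \<in> U. y < x} div d = j}) ` {..<card U div d}"
proof -
  \<comment> \<open>The position of \<open>x\<close> in \<open>U\<close>, counted from zero.\<close>
  define r where "r x = card {y \<in> U. y < x}" for x
  have r_less: "r x < r y" if "x \<in> U" "y \<in> U" "x < y" for x y
    unfolding r_def using that U by (intro psubset_card_mono) auto
  then have r_inj: "inj_on r U"
    by (intro inj_onI) (metis less_irrefl nat_neq_iff)
  have "\<Union>P \<subseteq> U"
    using P by blast
  then have finP: "finite P"
    using finite_UnionD[of P] finite_subset[OF _ U] \<open>\<Union>P \<subseteq> U\<close> by blast
  have fin: "finite B" if "B \<in> P" for B
    using P[OF that] U finite_subset by blast
  have disj: "pairwise disjnt P"
    unfolding pairwise_def disjnt_def using sep by fast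
  have card_Un: "card (\<Union>S) = d * card S" if "S \<subseteq> P" for S
  proof -
    have "card (\<Union>S) = sum card S"
      using that fin disj by (intro card_Union_disjoint) (auto intro: pairwise_subset)
    also have "\<dots> = (\<Sum>B\<in>S. d)"
      using that P by (intro sum.cong) auto
    finally show ?thesis
      by simp
  qed
  have "card U = card (\<Union>P) + card (U - \<Union>P)"
    using U \<open>\<Union>P \<subseteq> U\<close> by (metis card_Diff_subset card_mono finite_subset le_add_diff_inverse)
  then have card_P: "card U div d = card P"
    using card_Un[of P] rest(2) d by simp
  have "B \<in> (\<lambda>j. {x \<in> U. r x div d = j}) ` {..<card P}" if B: "B \<in> P" for B
  proof -
    \<comment> \<open>The blocks to the left of \<open>B\<close>; their number turns out to be the
      index of \<open>B\<close>.\<close>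
    define S where "S = {B' \<in> P. \<forall>x\<in>B'. \<forall>y\<in>B. x < y}"
    have "B \<noteq> {}"
      using P[OF B] d by auto
    then have "B \<notin> S"
      unfolding S_def by blast
    then have "S \<subset> P"
      using B unfolding S_def by blast
    then have S: "card S < card P"
      using finP by (rule psubset_card_mono[rotated])
    have "r x div d = card S" if x: "x \<in> B" for x
    proof -
      have "{y \<in> U. y < x} = \<Union>S \<union> {y \<in> B. y < x}"
      proof
        show "{y \<in> U. y < x} \<subseteq> \<Union>S \<union> {y \<in> B. y < x}"
        proof
          fix y
          assume y: "y \<in> {y \<in> U. y < x}"
          have "y \<in> \<Union>P"
          proof (rule ccontr)
            assume "y \<notin> \<Union>P"
            then have "y \<in> U - \<Union>P"
              using y by blast
            then show False
              using rest(1)[OF B x, of y] y by simp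
          qed
          then obtain B' where B': "B' \<in> P" "y \<in> B'"
            by blast
          show "y \<in> \<Union>S \<union> {y \<in> B. y < x}"
          proof (cases "B' = B")
            case False
            then have "B' \<in> S"
              using sep[OF B'(1) B] B' x y unfolding S_def by fastforce
            then show ?thesis
              using B' by blast
          qed (use B' y in auto)
        qed
        show "\<Union>S \<union> {y \<in> B. y < x} \<subseteq> {y \<in> U. y < x}"
          using P x B unfolding S_def by blast
      qed
      moreover have "\<Union>S \<inter> {y \<in> B. y < x} = {}"
        unfolding S_def by fastforce
      moreover have "finite (\<Union>S)"
        using \<open>S \<subset> P\<close> \<open>\<Union>P \<subseteq> U\<close> by (intro finite_subset[OF _ U]) blast
      moreover have "S \<subseteq> P"
        unfolding S_def by blast
      ultimately have "r x = d * card S + card {y \<in> B. y < x}"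
        unfolding r_def using fin[OF B] card_Un by (simp add: card_Un_disjoint)
      moreover have "card {y \<in> B. y < x} < d"
        using psubset_card_mono[of B "{y \<in> B. y < x}"] fin[OF B] x P[OF B] by fastforce
      ultimately show ?thesis
        by simp
    qed
    then have sub: "B \<subseteq> {x \<in> U. r x div d = card S}"
      using P[OF B] by blast
    \<comment> \<open>The reverse inclusion is by counting: only \<open>d\<close> positions have
      this quotient, and \<open>B\<close> already has \<open>d\<close> elements.\<close>
    have "r ` {x \<in> U. r x div d = card S} \<subseteq> {d * card S..<d * card S + d}"
    proof
      fix k
      assume "k \<in> r ` {x \<in> U. r x div d = card S}"
      then have "k div d = card S"
        by blast
      then show "k \<in> {d * card S..<d * card S + d}"
        using d mult_div_mod_eq[of d k] mod_less_divisor[OF d, of k] by auto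
    qed
    then have "card (r ` {x \<in> U. r x div d = card S}) \<le> card {d * card S..<d * card S + d}"
      by (intro card_mono) auto
    moreover have "card (r ` {x \<in> U. r x div d = card S}) = card {x \<in> U. r x div d = card S}"
      using r_inj by (intro card_image) (auto intro: inj_on_subset)
    ultimately have "card {x \<in> U. r x div d = card S} \<le> card B"
      using P[OF B] by simp
    then have "B = {x \<in> U. r x div d = card S}"
      using sub U by (intro card_seteq) auto
    then show ?thesis
      using S by blast
  qed
  \<comment> \<open>There are at most \<open>card P\<close> runs, so the inclusion of
    \<open>P\<close> among them is an equality.\<close>
  moreover have "card ((\<lambda>j. {x \<in> U. r x div d = j}) ` {..<card P}) \<le> card P"
    using card_image_le[of "{..<card P}"] by fastforce
  ultimately show ?thesis
    unfolding card_P r_def[symmetric] by (intro card_seteq) auto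
qed

definition constant_label :: "('g \<times> nat) set \<Rightarrow> bool" where
  "constant_label K \<longleftrightarrow> (\<forall>x\<in>K. \<forall>y\<in>K. fst x = fst y)"

definition column_sum :: "('g \<times> nat) set \<Rightarrow> int" where
  "column_sum K = (\<Sum>x\<in>K. int (snd x))"

lemma constant_label_eq:
  assumes "constant_label K" "constant_label K'" "x \<in> K" "x \<in> K'" "snd ` K = snd ` K'"
  shows "K = K'"
proof -
  have "A \<subseteq> B" if "constant_label A" "constant_label B" "x \<in> A" "x \<in> B" "snd ` A = snd ` B" for A B
  proof
    fix z
    assume z: "z \<in> A"
    then have "snd z \<in> snd ` B"
      using that(5) by blast
    then obtain z' where z': "z' \<in> B" "snd z' = snd z"
      by auto
    have "fst z = fst x" "fst z' = fst x"
      using that(1-4) z z'(1) unfolding constant_label_def by blast+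
    then show "z \<in> B"
      using z' by (metis prod_eqI)
  qed
  then show ?thesis
    using assms by (metis subset_antisym)
qed

context divisible_dowling
begin

text \<open>Lexicographically, \<open>weight\<close> first pushes \<open>J\<close> into the last columns, then spreads the column
  sums of the blocks apart, and finally counts non-constant labellings; all three quantities are
  sums over the blocks, and the coefficients make each one dominate the next.\<close>

definition block_weight :: "('g \<times> nat) set \<Rightarrow> int" where
  "block_weight K = (4 * int n * int n + 1) * column_sum K - 2 * (column_sum K)\<^sup>2 +
     (if constant_label K then 0 else 1)"

definition weight :: "'g dowling \<Rightarrow> int" where
  "weight u = sum block_weight (snd u)"

lemma column_sum_image: "inj_on snd K \<Longrightarrow> column_sum K = (\<Sum>m\<in>snd ` K. int m)"
  by (simp add: column_sum_def sum.reindex)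

lemma column_sum_bounds:
  assumes "K \<subseteq> X" "inj_on snd K"
  shows "column_sum K \<ge> 0" "column_sum K \<le> int n * int n"
proof -
  show "column_sum K \<ge> 0"
    unfolding column_sum_def by (intro sum_nonneg) simp
  have "snd ` K \<subseteq> {1..n}"
    using assms(1) by (auto simp: dowling_ground_def)
  then have "(\<Sum>m\<in>snd ` K. int m) \<le> (\<Sum>m\<in>{1..n}. int m)"
    by (intro sum_mono2) auto
  also have "\<dots> \<le> (\<Sum>m\<in>{1..n}. int n)"
    by (intro sum_mono) auto
  finally show "column_sum K \<le> int n * int n"
    using column_sum_image[OF assms(2)] by simp
qed

lemma inj_on_act: "g \<in> carrier G \<Longrightarrow> inj_on (act g) X"
  by (rule inj_onI) (auto simp: dowling_ground_def)

lemma block_weight_act: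
  assumes g: "g \<in> carrier G" and K: "K \<subseteq> X"
  shows "block_weight (act g ` K) = block_weight K"
proof -
  have "inj_on (act g) K"
    using inj_on_act[OF g] K by (rule inj_on_subset)
  then have "column_sum (act g ` K) = column_sum K"
    by (simp add: column_sum_def sum.reindex)
  moreover have "fst (act g x) = fst (act g y) \<longleftrightarrow> fst x = fst y" if "x \<in> K" "y \<in> K" for x y
    using that(1,2)[THEN subsetD[OF K]] g by (cases x; cases y) (simp add: dowling_ground_def)
  then have "constant_label (act g ` K) \<longleftrightarrow> constant_label K"
    by (auto simp: constant_label_def simp del: split_paired_All)
  ultimately show ?thesis
    by (simp add: block_weight_def)
qed

lemma weight_mk:
  assumes "transversal R"
  shows "weight (mk R) = int (order G) * sum block_weight R"
  unfolding weight_def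
proof (rule sum_mk[OF assms])
  fix g K
  assume "g \<in> carrier G" "K \<in> R"
  then show "block_weight (act g ` K) = block_weight K"
    using assms by (intro block_weight_act) (auto simp: transversal_def)
qed

section \<open>Atoms and their improvements\<close>

lemma atoms_M: "atoms M = {u \<in> T. rk u = 1}"
proof -
  have "covers M u zero" if "u \<in> T" "rk u = 1" for u
    using that covers_M_iff[OF zero_in_M T_subset_M] zero_le T_subset_Q rk_zero by simp
  then show ?thesis
    unfolding atoms_def M.bottom_eq_b using covers_zero by blast
qed

lemma atom_in_T: "a \<in> atoms M \<Longrightarrow> a \<in> T"
  by (simp add: atoms_M)

lemma atom_in_Q: "a \<in> atoms M \<Longrightarrow> a \<in> Q"
  using T_subset_Q[OF atom_in_T] .

lemma mk_in_atoms:
  assumes R: "transversal R"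
  shows "mk R \<in> atoms M \<longleftrightarrow> (\<forall>K\<in>R. d dvd card K) \<and> card R = n div d"
proof (cases "\<forall>K\<in>R. d dvd card K")
  case True
  then have "mk R \<in> T" "card R \<le> n div d"
    using mk_in_T[OF R] card_transversal_le[OF R] by blast+
  then show ?thesis
    using True rk_mk[OF R] by (auto simp: atoms_M)
next
  case False
  then show ?thesis
    using mk_in_T[OF R] by (auto simp: atoms_M)
qed

text \<open>Already with all sizes equal to \<open>d\<close>, the \<open>n div d\<close> blocks
  leave fewer than \<open>d\<close> columns, too few for any block to reach the next multiple of
  \<open>d\<close>.\<close>

lemma atom_transversal:
  assumes R: "transversal R" and a: "mk R \<in> atoms M"
  shows "K \<in> R \<Longrightarrow> card K = d" "card ({1..n} - snd ` \<Union>R) < d"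
proof -
  have dvd: "\<And>K. K \<in> R \<Longrightarrow> d dvd card K" and card: "card R = n div d"
    using a mk_in_atoms[OF R] by blast+
  have n: "n < d * Suc (n div d)"
    using d_ge2 dividend_less_times_div[of d n] by simp
  note sum = transversal_card_sum[OF R]
  have ge: "(\<Sum>K\<in>S. card K) \<ge> d * card S" if "S \<subseteq> R" for S
  proof -
    have "d * card S = (\<Sum>K\<in>S. d)"
      by simp
    also have "\<dots> \<le> (\<Sum>K\<in>S. card K)"
      using card_ge_d[OF R _ dvd] that by (intro sum_mono) blast
    finally show ?thesis .
  qed
  show "card ({1..n} - snd ` \<Union>R) < d"
    using sum ge[of R] n card by simp
  show "card K = d" if K: "K \<in> R"
  proof (rule ccontr)
    assume "card K \<noteq> d"
    moreover obtain c where c: "card K = d * c"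
      using dvd[OF K] by blast
    moreover have "c \<noteq> 0"
      using card_ge_d[OF R K dvd[OF K]] c d_ge2 by auto
    moreover have "c \<noteq> 1"
      using \<open>card K \<noteq> d\<close> c by auto
    ultimately have "d * 2 \<le> card K"
      unfolding c by (intro mult_le_mono2) linarith
    moreover have "(\<Sum>K\<in>R. card K) = card K + (\<Sum>K\<in>R - {K}. card K)"
      using sum.remove[OF transversal_finite[OF R] K] .
    moreover have "card R = Suc (card (R - {K}))"
      using card.remove[OF transversal_finite[OF R] K] .
    ultimately show False
      using sum ge[of "R - {K}"] n card by simp
  qed
qed

text \<open>The exchange condition in a form independent of the list: \<open>t\<close> is the
  required cover, and the strict drop of the weight puts \<open>a'\<close> before \<open>a\<close>
  in any list sorted by weight.\<close>

definition improvable :: "'g dowling \<Rightarrow> 'g dowling \<Rightarrow> bool" where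
  "improvable a y \<longleftrightarrow> (\<exists>a'\<in>atoms M. \<exists>t. dowling_le t y \<and> covers M t a \<and>
     dowling_le a' t \<and> a' \<noteq> t \<and> weight a' < weight a)"

lemma improvableI:
  assumes R: "transversal R" "mk R \<in> atoms M" and R': "transversal R'" "mk R' \<in> atoms M"
    and S: "transversal S" "mk S \<in> T" "card R = Suc (card S)" "dowling_le (mk R) (mk S)"
      "dowling_le (mk R') (mk S)" "dowling_le (mk S) y"
    and less: "sum block_weight R' < sum block_weight R"
  shows "improvable (mk R) y"
proof -
  have rk: "rk (mk R) = 1" "rk (mk R') = 1" "mk R \<in> T"
    using R(2) R'(2) atoms_M by auto
  moreover have "card R = n div d"
    using R mk_in_atoms by blast
  ultimately have rkS: "rk (mk S) = Suc (rk (mk R))"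
    using rk_mk[OF S(1,2)] S(3) by simp
  then have "covers M (mk S) (mk R)"
    using covers_M_iff[OF T_subset_M[OF rk(3)] T_subset_M[OF S(2)]] S(4) by simp
  moreover have "mk R' \<noteq> mk S"
    using rk rkS by auto
  moreover have "weight (mk R') < weight (mk R)"
    using less order_pos weight_mk R(1) R'(1) by simp
  ultimately show ?thesis
    unfolding improvable_def using R'(2) S(5,6) by blast
qed

section \<open>Improving an atom below a fixed element\<close>

context
  fixes J\<^sub>a \<pi>\<^sub>a J \<pi>
  assumes atom: "(J\<^sub>a, \<pi>\<^sub>a) \<in> atoms M" and y: "(J, \<pi>) \<in> Q"
    and le: "dowling_le (J\<^sub>a, \<pi>\<^sub>a) (J, \<pi>)"
begin

lemmas a_T = atom_in_T[OF atom] and a_Q = atom_in_Q[OF atom]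

lemma card_atom_block:
  assumes "K \<in> \<pi>\<^sub>a"
  shows "card K = d"
proof -
  obtain R where "transversal R" "K \<in> R" "(J\<^sub>a, \<pi>\<^sub>a) = mk R"
    using ex_transversal[OF a_Q transversal_single[OF a_Q assms]] assms
    by (metis empty_subsetI insert_subset)
  then show ?thesis
    using atom_transversal(1) atom by metis
qed

text \<open>As \<open>K\<close> lies in \<open>J\<close>, its columns can join the
  \<open>J\<close>-part without leaving the elements below \<open>(J, \<pi>)\<close>. From there any
  \<open>d\<close> columns of \<open>K\<close> and \<open>J\<^sub>a\<close> can be taken back as a
  block, with arbitrary labels.\<close>

lemma improve_J:
  assumes K: "K \<in> \<pi>\<^sub>a" "K \<subseteq> J"
    and K': "K' \<subseteq> X" "inj_on snd K'" "card K' = d" "snd ` K' \<subseteq> snd ` K \<union> snd ` J\<^sub>a"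
    and less: "block_weight K' < block_weight K"
  shows "improvable (J\<^sub>a, \<pi>\<^sub>a) (J, \<pi>)"
proof -
  obtain R where R: "transversal R" "K \<in> R" "R \<subseteq> \<pi>\<^sub>a" "(J\<^sub>a, \<pi>\<^sub>a) = mk R"
    using ex_transversal[OF a_Q transversal_single[OF a_Q K(1)]] K(1)
    by (metis empty_subsetI insert_subset)
  let ?S = "R - {K}"
  have S: "transversal ?S"
    using R(1) transversal_subset by blast
  have a: "mk R \<in> atoms M" and R_card: "\<And>K. K \<in> R \<Longrightarrow> card K = d"
    using atom R(4) atom_transversal(1)[OF R(1)] by auto
  have "finite K'"
    using K'(1) finite_X finite_subset by blast
  then have ne: "K' \<noteq> {}"
    using K'(3) d_ge2 by auto
  obtain x where x: "x \<in> K"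
    using block_nonempty[OF a_Q K(1)] by blast
  have cols: "snd ` K' \<inter> snd ` \<Union>?S = {}"
  proof -
    have "snd k \<noteq> snd k'" if "k \<in> K" "k' \<in> \<Union>?S" for k k'
      using transversal_block_eq[OF R(1,2), of _ k k'] that by blast
    moreover have "snd k \<noteq> snd k'" if k: "k \<in> J\<^sub>a" "k' \<in> \<Union>?S" for k k'
    proof
      assume eq: "snd k = snd k'"
      obtain K0 where K0: "K0 \<in> \<pi>\<^sub>a" "k' \<in> K0"
        using k(2) R(3) by blast
      then have "k' \<in> X" "k' \<notin> J\<^sub>a"
        using block_subset[OF a_Q K0(1)] block_J[OF a_Q K0] by blast+
      then show False
        using in_J_snd[OF a_Q k(1) _ eq] by blast
    qed
    ultimately have "c \<noteq> snd k'" if "c \<in> snd ` K \<union> snd ` J\<^sub>a" "k' \<in> \<Union>?S" for c k'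
      using that by (elim UnE imageE) simp_all
    then have "c \<notin> snd ` \<Union>?S" if "c \<in> snd ` K'" for c
      using that K'(4) by (meson imageE subsetD)
    then show ?thesis
      by (simp add: disjoint_iff)
  qed
  let ?R = "insert K' ?S"
  have R': "transversal ?R" "K' \<notin> ?S"
    using transversal_insert[OF S K'(1) ne K'(2) cols] by blast+
  have fin: "finite R"
    using transversal_finite[OF R(1)] .
  have card: "card R = Suc (card ?S)"
    using card.remove[OF fin R(2)] .
  then have "card ?R = n div d"
    using R' fin a mk_in_atoms[OF R(1)] by simp
  then have a': "mk ?R \<in> atoms M"
    using mk_in_atoms[OF R'(1)] R_card K'(3) by auto
  have "K' \<subseteq> fst (mk ?S)"
    using K'(1) cols unfolding mk_def by auto
  then have le': "dowling_le (mk ?R) (mk ?S)"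
    using mk_le_mkI[OF S R'(1)] by blast
  have le1: "dowling_le (mk R) (mk ?S)"
    using mk_remove_least(1)[OF R(1,2) x] .
  have T': "mk ?S \<in> T"
    using T_upward[OF a_T mk_in_Q[OF S]] le1 R(4) by simp
  have "dowling_le (mk ?S) (J, \<pi>)"
    using mk_remove_least(3)[OF R(1,2) x y] le R(4) x K(2) by auto
  moreover have "sum block_weight ?R < sum block_weight R"
    using less R'(2) fin sum.remove[OF fin R(2), of block_weight] by simp
  ultimately show ?thesis
    unfolding R(4) using improvableI[OF R(1) a R'(1) a' S T' card le1 le'] by blast
qed

text \<open>Translates share their columns, so different column sets mean different orbits, and
  \<open>K1\<close> and \<open>K2\<close> can be representatives at the same time. The common
  superset \<open>Z\<close> keeps their union below \<open>(J, \<pi>)\<close>.\<close>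

lemma improve_merge:
  assumes K: "K1 \<in> \<pi>\<^sub>a" "K2 \<in> \<pi>\<^sub>a" "snd ` K1 \<noteq> snd ` K2" "Z \<in> insert J \<pi>" "K1 \<subseteq> Z" "K2 \<subseteq> Z"
    and A: "A \<union> B = K1 \<union> K2" "A \<inter> B = {}" "card A = d" "card B = d"
    and less: "block_weight A + block_weight B < block_weight K1 + block_weight K2"
  shows "improvable (J\<^sub>a, \<pi>\<^sub>a) (J, \<pi>)"
proof -
  have conj: "K2 \<noteq> act g ` K1" if "g \<in> carrier G" for g
    using K(3) snd_image_dowling_act by metis
  note pair = transversal_pair[OF a_Q K(1,2) conj]
  obtain R where R: "transversal R" "K1 \<in> R" "K2 \<in> R" "(J\<^sub>a, \<pi>\<^sub>a) = mk R"
    using ex_transversal[OF a_Q pair(1)] K(1,2) by (metis empty_subsetI insert_subset)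
  let ?C = "R - {K1, K2}" and ?K = "K1 \<union> K2"
  let ?S = "insert ?K ?C" and ?R = "insert A (insert B ?C)"
  have a: "mk R \<in> atoms M" and R_card: "\<And>K. K \<in> R \<Longrightarrow> card K = d"
    using atom R(4) atom_transversal(1)[OF R(1)] by auto
  have S: "transversal ?S"
    using transversal_merge[OF R(1-3)] by blast
  have K_notin: "?K \<notin> ?C" and card: "card R = Suc (card ?S)"
    using card_transversal_merge[OF R(1-3) pair(2)] by blast+
  have C: "?S - {?K} = ?C"
    using K_notin by blast
  have ne: "A \<noteq> {}" "B \<noteq> {}"
    using A(3,4) d_ge2 by auto
  note split = transversal_split[OF S insertI1 A(1,2) ne, unfolded C]
  obtain x x' where x: "x \<in> K1" "x' \<in> K2"
    using block_nonempty[OF a_Q] K(1,2) by blast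
  have a': "mk ?R \<in> atoms M"
    using mk_in_atoms[OF split(1)] split(2) card a mk_in_atoms[OF R(1)] R_card A(3,4) by auto
  have le1: "dowling_le (mk R) (mk ?S)"
    using mk_merge_least(1)[OF R(1-3) x] .
  have T': "mk ?S \<in> T"
    using T_upward[OF a_T mk_in_Q[OF S]] le1 R(4) by simp
  have "(x, Some x') \<in> constraints (J, \<pi>)"
    using K(4-6) x by auto
  then have le2: "dowling_le (mk ?S) (J, \<pi>)"
    using mk_merge_least(2)[OF R(1-3) x y] le R(4) by simp
  have fin: "finite R"
    using transversal_finite[OF R(1)] .
  have "sum block_weight R = block_weight K1 + (block_weight K2 + sum block_weight (R - {K1} - {K2}))"
    using fin R(2,3) pair(2) sum.remove[of R K1 block_weight] sum.remove[of "R - {K1}" K2 block_weight]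
    by simp
  moreover have "R - {K1} - {K2} = ?C"
    by blast
  \<comment> \<open>A coincidence among \<open>A\<close>, \<open>B\<close> and the remaining blocks
    would make \<open>?R\<close> too small; without one the two weight sums can be compared term by
    term.\<close>
  moreover have "A \<notin> insert B ?C \<and> B \<notin> ?C"
  proof -
    have "card ?R = Suc (Suc (card ?C))"
      using split(2) K_notin fin by simp
    moreover have "card ?R \<le> Suc (card ?C)" if "A \<in> insert B ?C \<or> B \<in> ?C"
      using that fin card_insert_le_m1 by (auto simp: insert_absorb card_insert_if)
    ultimately show ?thesis
      by force
  qed
  ultimately have "sum block_weight ?R < sum block_weight R"
    using less fin by simp
  then show ?thesis
    unfolding R(4) using improvableI[OF R(1) a split(1) a' S T' card le1 split(3) le2] by blast
qed

text \<open>What the absence of improvements forces; it determines the atom.\<close>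

definition canonical :: bool where
  "canonical \<longleftrightarrow>
     (\<forall>K\<in>\<pi>\<^sub>a. K \<subseteq> J \<longrightarrow> constant_label K \<and> (\<forall>x\<in>K. \<forall>z\<in>J\<^sub>a. snd x < snd z)) \<and>
     (\<forall>K\<in>\<pi>\<^sub>a. \<forall>K'\<in>\<pi>\<^sub>a. \<forall>Z\<in>insert J \<pi>. K \<subseteq> Z \<longrightarrow> K' \<subseteq> Z \<longrightarrow> snd ` K \<noteq> snd ` K' \<longrightarrow>
        (\<forall>x\<in>K. \<forall>x'\<in>K'. snd x < snd x') \<or> (\<forall>x\<in>K. \<forall>x'\<in>K'. snd x' < snd x))"

text \<open>All competitors have the form \<open>{\<one>} \<times> B\<close>, so they carry no label
  cost. The first keeps the columns of \<open>K\<close> and only changes labels, the second trades a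
  column of \<open>K\<close> for a smaller one of \<open>J\<^sub>a\<close>.\<close>

lemma improvable_in_J:
  assumes K: "K \<in> \<pi>\<^sub>a" "K \<subseteq> J" and no: "\<not> improvable (J\<^sub>a, \<pi>\<^sub>a) (J, \<pi>)"
  shows "constant_label K" "x \<in> K \<Longrightarrow> z \<in> J\<^sub>a \<Longrightarrow> snd x < snd z"
proof -
  note sub = block_subset[OF a_Q K(1)] and inj = block_inj[OF a_Q K(1)]
  have cols: "snd ` K \<subseteq> {1..n}" "snd ` J\<^sub>a \<subseteq> {1..n}"
    using sub J_subset[OF a_Q] by (auto simp: dowling_ground_def)
  have card: "card (snd ` K) = d"
    using card_image[OF inj] card_atom_block[OF K(1)] by simp
  have no_better: "\<not> block_weight ({\<one>} \<times> B) < block_weight K"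
    if B: "card B = d" "B \<subseteq> snd ` K \<union> snd ` J\<^sub>a" for B
  proof
    assume "block_weight ({\<one>} \<times> B) < block_weight K"
    moreover have "B \<subseteq> {1..n}"
      using B(2) cols by blast
    then have "{\<one>} \<times> B \<subseteq> X"
      by (auto simp: dowling_ground_def)
    moreover have "inj_on snd ({\<one>} \<times> B)" "card ({\<one>} \<times> B) = d" "snd ` ({\<one>} \<times> B) = B"
      using B(1) by (auto simp: inj_on_def card_cartesian_product)
    ultimately show False
      using improve_J[OF K, of "{\<one>} \<times> B"] B(2) no by simp
  qed
  have sum_const: "column_sum ({\<one>} \<times> B) = (\<Sum>m\<in>B. int m)" for B
    using column_sum_image[of "{\<one>} \<times> B"] by (simp add: inj_on_def)
  have label_const: "constant_label ({\<one>} \<times> B)" for B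
    by (simp add: constant_label_def)
  show "constant_label K"
  proof (rule ccontr)
    assume "\<not> constant_label K"
    then have "block_weight ({\<one>} \<times> snd ` K) < block_weight K"
      using label_const[of "snd ` K"] sum_const[of "snd ` K"] column_sum_image[OF inj]
      by (simp add: block_weight_def)
    then show False
      using no_better[OF card] by blast
  qed
  show "snd x < snd z" if xz: "x \<in> K" "z \<in> J\<^sub>a"
  proof (rule ccontr)
    assume "\<not> snd x < snd z"
    moreover have z: "snd z \<notin> snd ` K"
    proof
      assume "snd z \<in> snd ` K"
      then obtain k where "k \<in> K" "snd z = snd k"
        by blast
      then show False
        using in_J_snd[OF a_Q xz(2), of k] sub block_J[OF a_Q K(1)] by blast
    qed
    ultimately have less: "snd z < snd x"
      using xz(1) by (metis imageI nat_neq_iff)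
    define B where "B = insert (snd z) (snd ` K - {snd x})"
    have fin: "finite (snd ` K)"
      using cols(1) finite_subset by blast
    have "card B = d"
      using fin z card card.remove[OF fin imageI[OF xz(1), of snd]]
      unfolding B_def by (subst card_insert_disjoint) auto
    moreover have "B \<subseteq> snd ` K \<union> snd ` J\<^sub>a"
      using xz(2) by (auto simp: B_def)
    moreover have "block_weight ({\<one>} \<times> B) < block_weight K"
    proof -
      define \<delta> where "\<delta> = int (snd x) - int (snd z)"
      define S where "S = column_sum K"
      have \<delta>: "\<delta> \<ge> 1"
        using less by (simp add: \<delta>_def)
      have S: "S \<ge> 0" "S \<le> int n * int n"
        using column_sum_bounds[OF sub inj] by (simp_all add: S_def)
      have "S = int (snd x) + (\<Sum>m\<in>snd ` K - {snd x}. int m)"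
        unfolding S_def column_sum_image[OF inj] using fin xz(1) by (intro sum.remove) auto
      moreover have "(\<Sum>m\<in>B. int m) = int (snd z) + (\<Sum>m\<in>snd ` K - {snd x}. int m)"
        using fin z by (simp add: B_def)
      ultimately have B: "column_sum ({\<one>} \<times> B) = S - \<delta>"
        unfolding sum_const \<delta>_def by simp
      \<comment> \<open>Column sums are at most \<open>n * n\<close>, so this coefficient exceeds
        \<open>4 * S\<close>: a smaller column sum always pays, in spite of the subtracted
        square.\<close>
      define A where "A = 4 * int n * int n + 1"
      have "4 * S - A < 0"
        using S(2) by (simp add: A_def)
      then have "\<delta> * (4 * S - A) < 0"
        using \<delta> by (intro mult_pos_neg) auto
      moreover have "A * (S - \<delta>) - 2 * (S - \<delta>)\<^sup>2 - (A * S - 2 * S\<^sup>2) = \<delta> * (4 * S - A) - 2 * \<delta>\<^sup>2"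
        by (simp add: power2_eq_square algebra_simps)
      ultimately have "A * (S - \<delta>) - 2 * (S - \<delta>)\<^sup>2 < A * S - 2 * S\<^sup>2"
        using zero_le_power2[of \<delta>] by linarith
      then show ?thesis
        unfolding block_weight_def B using label_const[of B] by (simp add: A_def S_def)
    qed
    ultimately show False
      using no_better by blast
  qed
qed

text \<open>If the points are inverted, let them change places, each keeping its label since labels
  inside a part of \<open>\<pi>\<close> are forced. The smaller column sum shrinks and the larger
  one grows, which lowers the concave term.\<close>

lemma improvable_in_block:
  assumes K: "K \<in> \<pi>\<^sub>a" "K' \<in> \<pi>\<^sub>a" "snd ` K \<noteq> snd ` K'" and Z: "Z \<in> insert J \<pi>" "K \<subseteq> Z" "K' \<subseteq> Z"
    and no: "\<not> improvable (J\<^sub>a, \<pi>\<^sub>a) (J, \<pi>)" and sum: "column_sum K \<le> column_sum K'"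
    and x: "x \<in> K" "x' \<in> K'"
  shows "snd x < snd x'"
proof (rule ccontr)
  assume "\<not> snd x < snd x'"
  moreover have cols: "snd k \<noteq> snd k'" if "k \<in> K" "k' \<in> K'" for k k'
    using block_translate[OF a_Q K(1,2) that] K(3) snd_image_dowling_act by metis
  then have "snd x \<noteq> snd x'"
    using x by blast
  ultimately have less: "snd x' < snd x"
    by simp
  have fin: "finite K" "finite K'"
    using block_subset[OF a_Q] K(1,2) finite_X finite_subset by metis+
  have disj: "K \<inter> K' = {}"
    using cols by blast
  define A B where "A = insert x' (K - {x})" and "B = insert x (K' - {x'})"
  have nin: "x' \<notin> K" "x \<notin> K'"
    using x disj by blast+
  have "A \<union> B = K \<union> K'" "A \<inter> B = {}"
    using x disj nin less by (auto simp: A_def B_def)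
  moreover have "card A = d" "card B = d"
    using card_atom_block K(1,2) x nin fin card.remove[of K x] card.remove[of K' x']
    by (simp_all add: A_def B_def)
  moreover have "block_weight A + block_weight B < block_weight K + block_weight K'"
  proof -
    define \<delta> where "\<delta> = int (snd x) - int (snd x')"
    define S S' where "S = column_sum K" and "S' = column_sum K'"
    define a where "a = 4 * int n * int n + 1"
    have \<delta>: "\<delta> \<ge> 1"
      using less by (simp add: \<delta>_def)
    have A: "column_sum A = S - \<delta>" and B: "column_sum B = S' + \<delta>"
      using fin nin x sum.remove[of K x "\<lambda>x. int (snd x)"] sum.remove[of K' x' "\<lambda>x. int (snd x)"]
      by (simp_all add: A_def B_def S_def S'_def \<delta>_def column_sum_def)
    \<comment> \<open>The linear terms of the two blocks cancel. The squares gain at least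
      \<open>4\<close>, while at most two blocks lose their constant labels, at a cost of
      \<open>2\<close>; with factor \<open>1\<close> instead of \<open>2\<close> on the square in
      \<open>block_weight\<close> the guaranteed gain would only be \<open>2\<close>.\<close>
    have "1 \<le> \<delta> * \<delta>" "0 \<le> \<delta> * (S' - S)"
      using \<delta> sum mult_mono[of 1 \<delta> 1 \<delta>] by (auto simp: S_def S'_def)
    moreover have "(a * (S - \<delta>) - 2 * (S - \<delta>)\<^sup>2) + (a * (S' + \<delta>) - 2 * (S' + \<delta>)\<^sup>2) =
        (a * S - 2 * S\<^sup>2) + (a * S' - 2 * S'\<^sup>2) - 4 * (\<delta> * (S' - S)) - 4 * (\<delta> * \<delta>)"
      by (simp add: power2_eq_square algebra_simps)
    ultimately have "(a * (S - \<delta>) - 2 * (S - \<delta>)\<^sup>2) + (a * (S' + \<delta>) - 2 * (S' + \<delta>)\<^sup>2) + 4 \<le>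
        (a * S - 2 * S\<^sup>2) + (a * S' - 2 * S'\<^sup>2)"
      by linarith
    moreover have "block_weight A \<le> a * (S - \<delta>) - 2 * (S - \<delta>)\<^sup>2 + 1"
      "block_weight B \<le> a * (S' + \<delta>) - 2 * (S' + \<delta>)\<^sup>2 + 1"
      by (simp_all add: block_weight_def A B a_def)
    moreover have "block_weight K \<ge> a * S - 2 * S\<^sup>2" "block_weight K' \<ge> a * S' - 2 * S'\<^sup>2"
      by (simp_all add: block_weight_def S_def S'_def a_def)
    ultimately show ?thesis
      by linarith
  qed
  ultimately show False
    using improve_merge[OF K Z, of A B] no by blast
qed

lemma canonicalI:
  assumes "\<not> improvable (J\<^sub>a, \<pi>\<^sub>a) (J, \<pi>)"
  shows canonical
  unfolding canonical_def
proof (intro conjI ballI impI)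
  fix K K' Z
  assume K: "K \<in> \<pi>\<^sub>a" "K' \<in> \<pi>\<^sub>a" "Z \<in> insert J \<pi>" "K \<subseteq> Z" "K' \<subseteq> Z" "snd ` K \<noteq> snd ` K'"
  show "(\<forall>x\<in>K. \<forall>x'\<in>K'. snd x < snd x') \<or> (\<forall>x\<in>K. \<forall>x'\<in>K'. snd x' < snd x)"
  proof (cases "column_sum K \<le> column_sum K'")
    case True
    then show ?thesis
      using improvable_in_block[OF K(1,2,6,3,4,5) assms] by blast
  next
    case False
    then have "column_sum K' \<le> column_sum K"
      by simp
    then show ?thesis
      using improvable_in_block[OF K(2,1) K(6)[symmetric] K(3,5,4) assms] by blast
  qed
qed (use improvable_in_J assms in blast)+

text \<open>The right-hand side does not mention the atom, so two canonical atoms use the same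
  column sets inside \<open>Z\<close>.\<close>

lemma canonical_columns:
  assumes canonical and Z: "Z \<in> insert J \<pi>"
  shows "{snd ` K |K. K \<in> \<pi>\<^sub>a \<and> K \<subseteq> Z} =
    (\<lambda>j. {c \<in> snd ` Z. card {c' \<in> snd ` Z. c' < c} div d = j}) ` {..<card (snd ` Z) div d}"
proof (rule separated_blocks)
  let ?P = "{snd ` K |K. K \<in> \<pi>\<^sub>a \<and> K \<subseteq> Z}"
  have Z_sub: "Z \<subseteq> X"
    using Z J_subset[OF y] block_subset[OF y] by blast
  then show "finite (snd ` Z)"
    using finite_X finite_subset by blast
  show "0 < d"
    using d_ge2 by simp
  show "B \<subseteq> snd ` Z \<and> card B = d" if "B \<in> ?P" for B
    using that card_image[OF block_inj[OF a_Q]] card_atom_block by auto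
  show "(\<forall>x\<in>B. \<forall>y\<in>B'. x < y) \<or> (\<forall>x\<in>B. \<forall>y\<in>B'. y < x)"
    if B: "B \<in> ?P" "B' \<in> ?P" "B \<noteq> B'" for B B'
  proof -
    obtain K K' where K: "K \<in> \<pi>\<^sub>a" "K \<subseteq> Z" "B = snd ` K" "K' \<in> \<pi>\<^sub>a" "K' \<subseteq> Z" "B' = snd ` K'"
      using B(1,2) by blast
    have "(\<forall>x\<in>K. \<forall>x'\<in>K'. snd x < snd x') \<or> (\<forall>x\<in>K. \<forall>x'\<in>K'. snd x' < snd x)"
      using conjunct2[OF assms(1)[unfolded canonical_def], rule_format, OF K(1,4) Z K(2,5)]
        B(3) K(3,6) by simp
    then show ?thesis
      unfolding K(3,6) by blast
  qed
  \<comment> \<open>Columns of \<open>Z\<close> can be left over only for \<open>Z = J\<close>, and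
    they then belong to \<open>J\<^sub>a\<close>; a part of \<open>\<pi>\<close> is filled
    completely by parts of the atom.\<close>
  have rest: "\<exists>z\<in>J\<^sub>a. c = snd z \<and> Z = J" if c: "c \<in> snd ` Z - \<Union>?P" for c
  proof -
    obtain z where z: "z \<in> Z" "c = snd z"
      using c by blast
    have "z \<in> J\<^sub>a"
    proof (rule ccontr)
      assume "z \<notin> J\<^sub>a"
      then obtain K where K: "K \<in> \<pi>\<^sub>a" "z \<in> K"
        using ex_block[OF a_Q] z(1) Z_sub by blast
      have "K \<subseteq> Z"
        using Z block_subset_J[OF a_Q y le K] block_subset_block[OF a_Q y le K] z(1) by blast
      then show False
        using c z(2) K by blast
    qed
    moreover have "J\<^sub>a \<subseteq> J"
      using le by simp
    ultimately show ?thesis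
      using Z z block_J[OF y] by blast
  qed
  show "x < c" if B: "B \<in> ?P" "x \<in> B" and c: "c \<in> snd ` Z - \<Union>?P" for B x c
  proof -
    obtain K k where K: "K \<in> \<pi>\<^sub>a" "K \<subseteq> Z" "k \<in> K" "x = snd k"
      using B by blast
    then show ?thesis
      using rest[OF c] assms unfolding canonical_def by blast
  qed
  \<comment> \<open>The columns of \<open>J\<^sub>a\<close> are those missed by all representatives,
    and an atom misses fewer than \<open>d\<close>.\<close>
  obtain R where R: "transversal R" "(J\<^sub>a, \<pi>\<^sub>a) = mk R"
    using ex_transversal[OF a_Q transversal_empty empty_subsetI] by metis
  have "J\<^sub>a = fst (mk R)"
    using R(2) by (metis fst_conv)
  then have "snd ` J\<^sub>a \<subseteq> {1..n} - snd ` \<Union>R"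
    by (auto simp: mk_def dowling_ground_def)
  moreover have "snd ` Z - \<Union>?P \<subseteq> snd ` J\<^sub>a"
  proof
    fix c
    assume "c \<in> snd ` Z - \<Union>?P"
    then show "c \<in> snd ` J\<^sub>a"
      using rest[of c] by auto
  qed
  ultimately have "snd ` Z - \<Union>?P \<subseteq> {1..n} - snd ` \<Union>R"
    by (rule order_trans[rotated])
  then have "card (snd ` Z - \<Union>?P) \<le> card ({1..n} - snd ` \<Union>R)"
    by (intro card_mono) auto
  then show "card (snd ` Z - \<Union>?P) < d"
    using atom_transversal(2)[OF R(1)] atom R(2) by simp
qed

end

text \<open>The column sets agree, so only labels have to be recovered. Inside a part of
  \<open>\<pi>\<close> each column carries one point, which fixes them. Inside \<open>J\<close>
  constancy leaves a single label open, and the translates of \<open>K'\<close> realise every choice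
  of it.\<close>

lemma canonical_subset:
  assumes y: "(J, \<pi>) \<in> Q"
    and a: "(J1, \<pi>1) \<in> atoms M" "dowling_le (J1, \<pi>1) (J, \<pi>)" "canonical J1 \<pi>1 J \<pi>"
    and a': "(J2, \<pi>2) \<in> atoms M" "dowling_le (J2, \<pi>2) (J, \<pi>)" "canonical J2 \<pi>2 J \<pi>"
  shows "\<pi>1 \<subseteq> \<pi>2"
proof
  fix K
  assume K: "K \<in> \<pi>1"
  note Q1 = atom_in_Q[OF a(1)] and Q2 = atom_in_Q[OF a'(1)]
  have "K \<subseteq> J \<or> (\<exists>Z\<in>\<pi>. K \<subseteq> Z)"
    using a(2) K by simp
  then obtain Z where Z: "Z \<in> insert J \<pi>" "K \<subseteq> Z"
    by auto
  have "snd ` K \<in> {snd ` K' |K'. K' \<in> \<pi>1 \<and> K' \<subseteq> Z}"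
    using K Z(2) by blast
  also have "\<dots> = {snd ` K' |K'. K' \<in> \<pi>2 \<and> K' \<subseteq> Z}"
    by (rule trans[OF canonical_columns[OF a(1) y a(2,3) Z(1)]
          canonical_columns[OF a'(1) y a'(2,3) Z(1), symmetric]])
  finally have "snd ` K \<in> {snd ` K' |K'. K' \<in> \<pi>2 \<and> K' \<subseteq> Z}" .
  then obtain K' where K': "K' \<in> \<pi>2" "K' \<subseteq> Z" "snd ` K = snd ` K'"
    by blast
  show "K \<in> \<pi>2"
  proof (cases "Z = J")
    case False
    then have "inj_on snd Z"
      using block_inj[OF y] Z(1) by blast
    then have "K = K'"
      using inj_on_image_eq_iff Z(2) K'(2,3) by metis
    then show ?thesis
      using K'(1) by simp
  next
    case True
    obtain x where x: "x \<in> K"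
      using block_nonempty[OF Q1 K] by blast
    then obtain x' where x': "x' \<in> K'" "snd x' = snd x"
      using K'(3) by (metis imageE imageI)
    obtain g where g: "g \<in> carrier G" "x = act g x'"
      using act_transitive[of x' x] x' x block_subset[OF Q1 K] block_subset[OF Q2 K'(1)] by blast
    have gK': "act g ` K' \<in> \<pi>2" "act g ` K' \<subseteq> J"
      using act_block[OF Q2 g(1) K'(1)] act_J[OF y g(1)] K'(2) True by blast+
    have "constant_label K" "constant_label (act g ` K')"
      using a(3) a'(3) K Z(2) True gK' unfolding canonical_def[OF a(1) y a(2)] canonical_def[OF a'(1) y a'(2)]
      by blast+
    moreover have "snd ` K = snd ` act g ` K'"
      using K'(3) by (simp only: snd_image_dowling_act)
    ultimately have "K = act g ` K'"
      using constant_label_eq[of K "act g ` K'" x] x x'(1) g(2) by blast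
    then show ?thesis
      using gK'(1) by simp
  qed
qed

lemma not_improvable_unique:
  assumes y: "y \<in> Q"
    and a: "a \<in> atoms M" "dowling_le a y" "\<not> improvable a y"
    and a': "a' \<in> atoms M" "dowling_le a' y" "\<not> improvable a' y"
  shows "a = a'"
proof -
  obtain J \<pi> J1 \<pi>1 J2 \<pi>2 where eq: "y = (J, \<pi>)" "a = (J1, \<pi>1)" "a' = (J2, \<pi>2)"
    by (cases y; cases a; cases a')
  note y = y[unfolded eq] and a = a[unfolded eq] and a' = a'[unfolded eq]
  note c = canonicalI[OF a(1) y a(2,3)] and c' = canonicalI[OF a'(1) y a'(2,3)]
  have \<pi>: "\<pi>1 = \<pi>2"
    using canonical_subset[OF y a(1,2) c a'(1,2) c'] canonical_subset[OF y a'(1,2) c' a(1,2) c] by blast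
  have "J1 = X - \<Union>\<pi>1" "J2 = X - \<Union>\<pi>2"
    using partition[OF atom_in_Q[OF a(1)]] J_subset[OF atom_in_Q[OF a(1)]]
      partition[OF atom_in_Q[OF a'(1)]] J_subset[OF atom_in_Q[OF a'(1)]]
    unfolding partition_on_def by blast+
  then show ?thesis
    unfolding eq \<pi> by simp
qed

lemma finite_atoms: "finite (atoms M)"
  using M.finite_carrier by (rule finite_subset[rotated]) (auto simp: atoms_def covers_def)

text \<open>If the atom is not the first one below \<open>y\<close>, it is improvable: otherwise it would be the
  unique non-improvable atom below \<open>y\<close>, as is every atom of minimal weight below \<open>y\<close>.\<close>

lemma improvable_if_not_first:
  assumes y: "y \<in> Q" and a: "a \<in> atoms M" "dowling_le a y"
    and a': "a' \<in> atoms M" "dowling_le a' y" "weight a' \<le> weight a" "a' \<noteq> a"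
  shows "improvable a y"
proof (rule ccontr)
  assume no: "\<not> improvable a y"
  let ?A = "{b \<in> atoms M. dowling_le b y}"
  have fin: "finite ?A"
    using finite_atoms by simp
  have min_not_improvable: "\<not> improvable b y" if b: "b \<in> ?A" "\<And>c. c \<in> ?A \<Longrightarrow> weight b \<le> weight c" for b
  proof
    assume "improvable b y"
    then obtain c t where ct: "c \<in> atoms M" "dowling_le t y" "covers M t b" "dowling_le c t" "weight c < weight b"
      unfolding improvable_def by blast
    have "dowling_le c y"
      using le_trans[OF _ _ y ct(4,2)] ct(1,3) carrier_M_subset by (auto simp: atoms_def covers_def)
    then show False
      using b(2)[of c] ct(1,5) by simp
  qed
  have "Min (weight ` ?A) \<in> weight ` ?A"
    using fin a by (intro Min_in finite_imageI) blast+
  then obtain b where b: "b \<in> ?A" "weight b = Min (weight ` ?A)"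
    by auto
  then have min: "weight b \<le> weight c" if "c \<in> ?A" for c
    using that fin by simp
  have "b = a"
    using not_improvable_unique[OF y _ _ min_not_improvable[OF b(1) min] a no] b(1) by blast
  then have "\<not> improvable a' y"
    using min_not_improvable[of a'] a' min order_trans[OF a'(3)] by simp
  then show False
    using not_improvable_unique[OF y a no a'(1,2)] a'(4) by blast
qed

lemma has_recursive_atom_ordering_M: "has_recursive_atom_ordering M"
proof -
  obtain xs where xs: "distinct xs" "set xs = atoms M"
    using finite_distinct_list[OF finite_atoms] by blast
  \<comment> \<open>Ties may be broken arbitrarily: \<open>improvable_if_not_first\<close> also
    accepts an earlier atom of equal weight.\<close>
  define as where "as = sort_key weight xs"
  have as: "distinct as" "set as = atoms M"
    using xs by (simp_all add: as_def)
  have sorted: "weight (as ! i) \<le> weight (as ! j)" if "i \<le> j" "j < length as" for i j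
    using sorted_nth_mono[of "map weight as" i j] that by (simp add: as_def)
  have "recursive_atom_ordering M as"
  proof (rule M.recursive_atom_orderingI[OF as])
    fix a bs
    assume "covers M a zero" and bs: "distinct bs" "set bs = atoms (interval_poset M a (mk {}))"
    then have a: "a \<in> T"
      using covers_zero by blast
    then have "graded_poset (interval_poset M a (mk {})) rk a (mk {})"
      using M.graded_interval[OF T_subset_M T_subset_M[OF top_in_T]] le_top T_subset_Q by simp
    then show "recursive_atom_ordering (interval_poset M a (mk {})) bs"
      using upper_semimodular_above[OF a] bs by (rule recursive_atom_ordering_semimodular)
  next
    fix i j y
    assume ij: "i < j" "j < length as" and y: "y \<in> carrier M" "as ! i \<sqsubset>\<^bsub>M\<^esub> y" "as ! j \<sqsubset>\<^bsub>M\<^esub> y"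
    have a: "as ! i \<in> atoms M" "as ! j \<in> atoms M" "as ! i \<noteq> as ! j"
      using ij as nth_mem nth_eq_iff_index_eq by (metis order.strict_trans nat_neq_iff)+
    have "improvable (as ! j) y"
      using improvable_if_not_first[OF carrier_M_subset[OF y(1)] a(2) _ a(1)] a(3) y(2,3) sorted[of i j] ij
      by (simp add: lless_M)
    then obtain a' t where t: "a' \<in> atoms M" "dowling_le t y" "covers M t (as ! j)" "dowling_le a' t" "a' \<noteq> t"
      "weight a' < weight (as ! j)"
      unfolding improvable_def by blast
    obtain k where k: "k < length as" "a' = as ! k"
      using t(1) as(2) by (metis in_set_conv_nth)
    have "k < j"
      using sorted[of j k] k t(6) by force
    then show "\<exists>k<j. \<exists>z\<in>carrier M. z \<sqsubseteq>\<^bsub>M\<^esub> y \<and> covers M z (as ! j) \<and> as ! k \<sqsubset>\<^bsub>M\<^esub> z"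
      using t k by (intro exI[of _ k] conjI bexI[of _ t]) (auto simp: lless_M covers_def)
  qed
  then show ?thesis
    unfolding has_recursive_atom_ordering_def by blast
qed

end

theorem proposition1p6:
  fixes G :: "('g, 'b) monoid_scheme" and n d :: nat
  assumes "group G" and "finite (carrier G)" and "n \<ge> 1" and "d \<ge> 2"
  shows "pure_poset (dowling_mod G n d)
    \<and> upper_semilattice (dowling_mod G n d)
    \<and> has_recursive_atom_ordering (dowling_mod G n d)
    \<and> (\<forall>(J, \<pi>) \<in> carrier (dowling_mod G n d).
         real (poset_rank (dowling_mod G n d) (J, \<pi>)) =
           (if (J, \<pi>) = dowling_zero G n then 0
            else real (n div d) + 1 - real (card \<pi>) / real (order G)))
    \<and> poset_length (dowling_mod G n d) = n div d + 1"
proof -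
  interpret divisible_dowling G n d
    using assms by (simp add: divisible_dowling_def dowling_def dowling_axioms_def divisible_dowling_axioms_def)
  have "poset_length M = n div d + 1"
    using M.length_eq rk_top rk_zero by simp
  then show ?thesis
    using M.pure upper_semilattice_M has_recursive_atom_ordering_M rank_formula by blast
qed

end
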